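(* Let $\Lambda$ be a dominant integral weight of the affine Lie algebra $A^{(1)}_\ell$. Let $d$ be a positive integer, let $\lambda\in P(\Lambda)$ be a weight of defect $d$ with hub $(\theta_0,\dots,\theta_\ell)$, and let $i\in\{0,\dots,\ell\}$. If $d\le|\theta_i|$, then $\lambda$ is $i$-external.
   Context: Let $\mathfrak g$ be the affine Lie algebra $A^{(1)}_\ell$, $e=\ell+1\ge 2$, with simple roots $\alpha_0,\dots,\alpha_\ell$, simple coroots $\alpha_i^\vee$, fundamental weights $\Lambda_0,\dots,\Lambda_\ell$ and null root $\delta=\alpha_0+\dots+\alpha_\ell$. Let $(\cdot\mid\cdot)$ be the standard symmetric form on the weight space, so that $(\lambda\mid\alpha_i)=\langle\lambda,\alpha_i^\vee\rangle$ and $(\alpha_i\mid\alpha_j)$ is the $(i,j)$ entry of the Cartan matrix. Let $Q_+=\bigoplus_i\mathbb Z_{\ge0}\alpha_i$. Let $\Lambda=a_0\Lambda_0+\dots+a_\ell\Lambda_\ell$ be a dominant integral weight, $V(\Lambda)$ the irreducible highest weight module of highest weight $\Lambda$, $P(\Lambda)$ its set of weights, and $B(\Lambda)$ its Kashiwara crystal with crystal operators $\tilde e_i,\tilde f_i$. Every $\lambda\in P(\Lambda)$ has the form $\Lambda-\alpha$ with $\alpha\in Q_+$. Its defect is $\operatorname{def}(\lambda)=\tfrac12\big((\Lambda\mid\Lambda)-(\lambda\mid\lambda)\big)=(\Lambda\mid\alpha)-\tfrac12(\alpha\mid\alpha)$, and its hub is $(\theta_0,\dots,\theta_\ell)$ with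 $\theta_i=\langle\lambda,\alpha_i^\vee\rangle$. An element $b\in B(\Lambda)$ whose weight has hub $(\theta_0,\dots,\theta_\ell)$ is $i$-external if $\tilde e_i(b)=0$ whenever $\theta_i>0$, and $\tilde f_i(b)=0$ whenever $\theta_i<0$. A weight $\lambda\in P(\Lambda)$ is called $i$-external if every $b\in B(\Lambda)$ of weight $\lambda$ is $i$-external. *)

theory Defs
  imports Complex_Main
    "HOL-Computational_Algebra.Polynomial"
    "HOL-Computational_Algebra.Fraction_Field"
    "HOL-Library.Function_Algebras"
    "HOL-Library.Product_Plus"
begin

section \<open>Weights of the affine Lie algebra of type A\<close>

text \<open>
  Throughout, l is the rank, l \<open>\<ge>\<close> 1, and vertices of the Dynkin diagram are the naturals i \<open>\<le>\<close> l,
  read modulo l + 1.  For l = 1 both neighbours coincide and the off-diagonal entries are -2.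
\<close>

definition cartan :: "nat \<Rightarrow> nat \<Rightarrow> nat \<Rightarrow> int" where
  "cartan l i j =
     2 * of_bool (i = j) - of_bool (j = Suc i mod Suc l) - of_bool (i = Suc j mod Suc l)"

text \<open>
  A weight (m, n) stands for \<open>m\<^sub>0 \<Lambda>\<^sub>0 + \<dots> + m\<^sub>l \<Lambda>\<^sub>l + n \<delta>\<close>, and a coweight (x, y) for
  \<open>x\<^sub>0 \<alpha>\<^sub>0\<^sup>\<vee> + \<dots> + x\<^sub>l \<alpha>\<^sub>l\<^sup>\<vee> + y d\<close>, d being the scaling element: \<open>\<alpha>\<^sub>i(d) = 1\<close> for i = 0 and 0 otherwise,
  \<open>\<Lambda>\<^sub>i(d) = 0\<close>, \<open>\<delta>(d) = 1\<close>.  The lattices consist of the pairs whose first component vanishes beyond l.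
\<close>

type_synonym weight = "(nat \<Rightarrow> int) \<times> int"
type_synonym coweight = "(nat \<Rightarrow> int) \<times> int"

definition weight_lattice :: "nat \<Rightarrow> weight set" where
  "weight_lattice l = {\<mu>. \<forall>j>l. fst \<mu> j = 0}"

definition coweight_lattice :: "nat \<Rightarrow> coweight set" where
  "coweight_lattice l = {h. \<forall>j>l. fst h j = 0}"

definition pairing :: "nat \<Rightarrow> weight \<Rightarrow> coweight \<Rightarrow> int" where
  "pairing l \<mu> h = (\<Sum>j\<le>l. fst \<mu> j * fst h j) + snd \<mu> * snd h"

definition fundamental_weight :: "nat \<Rightarrow> weight" where
  "fundamental_weight i = ((\<lambda>j. of_bool (j = i)), 0)"

definition null_root :: weight where
  "null_root = (0, 1)"

definition simple_root :: "nat \<Rightarrow> nat \<Rightarrow> weight" where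
  "simple_root l i = ((\<lambda>j. if j \<le> l then cartan l j i else 0), of_bool (i = 0))"

definition simple_coroot :: "nat \<Rightarrow> coweight" where
  "simple_coroot i = ((\<lambda>j. of_bool (j = i)), 0)"

definition scaling_element :: coweight where
  "scaling_element = (0, 1)"

definition hub :: "nat \<Rightarrow> weight \<Rightarrow> nat \<Rightarrow> int" where
  "hub l \<mu> i = pairing l \<mu> (simple_coroot i)"

definition dominant_weight :: "nat \<Rightarrow> (nat \<Rightarrow> nat) \<Rightarrow> weight" where
  "dominant_weight l a = (\<Sum>i\<le>l. \<Sum>_<a i. fundamental_weight i)"

text \<open>
  The normalised invariant form, with \<open>(\<Lambda>\<^sub>0 | \<Lambda>\<^sub>0) = 0\<close>.  The entries
  \<open>(\<Lambda>\<^sub>j | \<Lambda>\<^sub>k) = min(j,k) - jk/(l+1)\<close> are those of the inverse of the finite Cartan matrix \<open>A\<^sub>l\<close>, extended by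
  zero, and \<open>(\<Lambda>\<^sub>j | \<delta>) = 1\<close>, \<open>(\<delta> | \<delta>) = 0\<close>.
\<close>

definition wt_form :: "nat \<Rightarrow> weight \<Rightarrow> weight \<Rightarrow> rat" where
  "wt_form l \<mu> \<nu> =
     (\<Sum>j\<le>l. \<Sum>k\<le>l. of_int (fst \<mu> j) * of_int (fst \<nu> k)
                    * (of_nat (min j k) - of_nat (j * k) / of_nat (Suc l)))
     + (\<Sum>j\<le>l. of_int (fst \<mu> j)) * of_int (snd \<nu>)
     + of_int (snd \<mu>) * (\<Sum>k\<le>l. of_int (fst \<nu> k))"

definition defect :: "nat \<Rightarrow> weight \<Rightarrow> weight \<Rightarrow> rat" where
  "defect l \<Lambda> \<mu> = (wt_form l \<Lambda> \<Lambda> - wt_form l \<mu> \<mu>) / 2"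


section \<open>The irreducible highest weight module over the affine Lie algebra\<close>

text \<open>
  A module structure is a scalar multiplication together with the action of the Chevalley generators
  \<open>e\<^sub>i, f\<^sub>i, h\<^sub>i = \<alpha>\<^sub>i\<^sup>\<vee>\<close> and of d; the type \<open>'v\<close> is the underlying space.
\<close>

record 'v affine_module =
  sc :: "complex \<Rightarrow> 'v \<Rightarrow> 'v"
  e_op :: "nat \<Rightarrow> 'v \<Rightarrow> 'v"
  f_op :: "nat \<Rightarrow> 'v \<Rightarrow> 'v"
  h_op :: "nat \<Rightarrow> 'v \<Rightarrow> 'v"
  d_op :: "'v \<Rightarrow> 'v"

definition commutator :: "('v \<Rightarrow> 'v) \<Rightarrow> ('v \<Rightarrow> 'v) \<Rightarrow> 'v \<Rightarrow> 'v::ab_group_add" where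
  "commutator X Y v = X (Y v) - Y (X v)"

definition affine_ops :: "nat \<Rightarrow> 'v affine_module \<Rightarrow> ('v \<Rightarrow> 'v) set" where
  "affine_ops l V = e_op V ` {..l} \<union> f_op V ` {..l} \<union> h_op V ` {..l} \<union> {d_op V}"

definition is_affine_module :: "nat \<Rightarrow> 'v::ab_group_add affine_module \<Rightarrow> bool" where
  "is_affine_module l V \<longleftrightarrow>
     vector_space (sc V) \<and>
     (\<forall>T\<in>affine_ops l V. Vector_Spaces.linear (sc V) (sc V) T) \<and>
     (\<forall>i\<le>l. \<forall>j\<le>l. commutator (h_op V i) (h_op V j) = 0) \<and>
     (\<forall>i\<le>l. commutator (d_op V) (h_op V i) = 0) \<and>
     (\<forall>i\<le>l. \<forall>j\<le>l. \<forall>v. commutator (h_op V i) (e_op V j) v = sc V (of_int (cartan l i j)) (e_op V j v)) \<and>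
     (\<forall>i\<le>l. \<forall>j\<le>l. \<forall>v. commutator (h_op V i) (f_op V j) v = sc V (- of_int (cartan l i j)) (f_op V j v)) \<and>
     (\<forall>j\<le>l. \<forall>v. commutator (d_op V) (e_op V j) v = sc V (of_bool (j = 0)) (e_op V j v)) \<and>
     (\<forall>j\<le>l. \<forall>v. commutator (d_op V) (f_op V j) v = sc V (- of_bool (j = 0)) (f_op V j v)) \<and>
     (\<forall>i\<le>l. \<forall>j\<le>l. \<forall>v. commutator (e_op V i) (f_op V j) v = (if i = j then h_op V i v else 0)) \<and>
     (\<forall>i\<le>l. \<forall>j\<le>l. i \<noteq> j \<longrightarrow>
        (commutator (e_op V i) ^^ nat (1 - cartan l i j)) (e_op V j) = 0 \<and>
        (commutator (f_op V i) ^^ nat (1 - cartan l i j)) (f_op V j) = 0)"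

definition weight_space :: "nat \<Rightarrow> 'v::ab_group_add affine_module \<Rightarrow> weight \<Rightarrow> 'v set" where
  "weight_space l V \<mu> =
     {v. (\<forall>i\<le>l. h_op V i v = sc V (of_int (pairing l \<mu> (simple_coroot i))) v) \<and>
         d_op V v = sc V (of_int (pairing l \<mu> scaling_element)) v}"

definition irreducible_ops :: "('k::field \<Rightarrow> 'v \<Rightarrow> 'v::ab_group_add) \<Rightarrow> ('v \<Rightarrow> 'v) set \<Rightarrow> bool" where
  "irreducible_ops s Ops \<longleftrightarrow>
     UNIV \<noteq> {0::'v} \<and>
     (\<forall>W. module.subspace s W \<and> (\<forall>T\<in>Ops. T ` W \<subseteq> W) \<longrightarrow> W = {0} \<or> W = UNIV)"

text \<open>
  \<open>is_V l \<Lambda> V\<close>: V is (a model of) the module \<open>V(\<Lambda>)\<close>, which is unique up to isomorphism.  Irreducibility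
  forces the highest weight vector to generate.
\<close>

definition is_V :: "nat \<Rightarrow> weight \<Rightarrow> 'v::ab_group_add affine_module \<Rightarrow> bool" where
  "is_V l \<Lambda> V \<longleftrightarrow>
     is_affine_module l V \<and> irreducible_ops (sc V) (affine_ops l V) \<and>
     (\<exists>v\<in>weight_space l V \<Lambda>. v \<noteq> 0 \<and> (\<forall>i\<le>l. e_op V i v = 0))"

definition weights :: "nat \<Rightarrow> 'v::ab_group_add affine_module \<Rightarrow> weight set" where
  "weights l V = {\<mu>\<in>weight_lattice l. weight_space l V \<mu> \<noteq> {0}}"


section \<open>The quantum affine algebra and its irreducible highest weight module\<close>

type_synonym ratfun = "rat poly fract"

definition qvar :: ratfun where
  "qvar = Fract [:0, 1:] 1"

text \<open>The local ring of rational functions in q that are regular at q = 0.\<close>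

definition regular_at_0 :: "ratfun set" where
  "regular_at_0 = {Fract a b | a b. poly b 0 \<noteq> 0}"

definition q_int :: "nat \<Rightarrow> ratfun" where
  "q_int n = (qvar powi int n - qvar powi (- int n)) / (qvar - inverse qvar)"

definition q_fact :: "nat \<Rightarrow> ratfun" where
  "q_fact n = (\<Prod>k=1..n. q_int k)"

text \<open>\<open>qk M h\<close> is the action of \<open>q\<^sup>h\<close>, for h in the coweight lattice.\<close>

record 'v quantum_module =
  qsc :: "ratfun \<Rightarrow> 'v \<Rightarrow> 'v"
  qe :: "nat \<Rightarrow> 'v \<Rightarrow> 'v"
  qf :: "nat \<Rightarrow> 'v \<Rightarrow> 'v"
  qk :: "coweight \<Rightarrow> 'v \<Rightarrow> 'v"

definition divided_power :: "'v quantum_module \<Rightarrow> ('v \<Rightarrow> 'v) \<Rightarrow> nat \<Rightarrow> 'v \<Rightarrow> 'v" where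
  "divided_power M T n v = qsc M (inverse (q_fact n)) ((T ^^ n) v)"

definition quantum_serre ::
    "nat \<Rightarrow> 'v::ab_group_add quantum_module \<Rightarrow> (nat \<Rightarrow> 'v \<Rightarrow> 'v) \<Rightarrow> nat \<Rightarrow> nat \<Rightarrow> bool" where
  "quantum_serre l M X i j \<longleftrightarrow>
     (let b = nat (1 - cartan l i j) in
      \<forall>v. (\<Sum>k\<le>b. qsc M ((- 1) ^ k)
                (divided_power M (X i) k (X j (divided_power M (X i) (b - k) v)))) = 0)"

definition quantum_ops :: "nat \<Rightarrow> 'v quantum_module \<Rightarrow> ('v \<Rightarrow> 'v) set" where
  "quantum_ops l M = qe M ` {..l} \<union> qf M ` {..l} \<union> qk M ` coweight_lattice l"

text \<open>
  Modules over \<open>U\<^sub>q(\<gg>)\<close>.  As \<open>(\<alpha>\<^sub>i | \<alpha>\<^sub>i) = 2\<close> for all i, one has \<open>q\<^sub>i = q\<close> and \<open>t\<^sub>i = q\<^sup>h\<close> for \<open>h = \<alpha>\<^sub>i\<^sup>\<vee>\<close>.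
\<close>

definition is_quantum_module :: "nat \<Rightarrow> 'v::ab_group_add quantum_module \<Rightarrow> bool" where
  "is_quantum_module l M \<longleftrightarrow>
     vector_space (qsc M) \<and>
     (\<forall>T\<in>quantum_ops l M. Vector_Spaces.linear (qsc M) (qsc M) T) \<and>
     qk M 0 = id \<and>
     (\<forall>h\<in>coweight_lattice l. \<forall>h'\<in>coweight_lattice l. qk M (h + h') = qk M h \<circ> qk M h') \<and>
     (\<forall>h\<in>coweight_lattice l. \<forall>i\<le>l. \<forall>v.
        qk M h (qe M i (qk M (- h) v)) = qsc M (qvar powi pairing l (simple_root l i) h) (qe M i v) \<and>
        qk M h (qf M i (qk M (- h) v)) = qsc M (qvar powi (- pairing l (simple_root l i) h)) (qf M i v)) \<and>
     (\<forall>i\<le>l. \<forall>j\<le>l. \<forall>v. commutator (qe M i) (qf M j) v =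
        (if i = j then qsc M (inverse (qvar - inverse qvar))
                         (qk M (simple_coroot i) v - qk M (- simple_coroot i) v)
         else 0)) \<and>
     (\<forall>i\<le>l. \<forall>j\<le>l. i \<noteq> j \<longrightarrow> quantum_serre l M (qe M) i j \<and> quantum_serre l M (qf M) i j)"

definition q_weight_space :: "nat \<Rightarrow> 'v::ab_group_add quantum_module \<Rightarrow> weight \<Rightarrow> 'v set" where
  "q_weight_space l M \<mu> =
     {v. \<forall>h\<in>coweight_lattice l. qk M h v = qsc M (qvar powi pairing l \<mu> h) v}"

definition is_Vq :: "nat \<Rightarrow> weight \<Rightarrow> 'v::ab_group_add quantum_module \<Rightarrow> bool" where
  "is_Vq l \<Lambda> M \<longleftrightarrow>
     is_quantum_module l M \<and> irreducible_ops (qsc M) (quantum_ops l M) \<and>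
     (\<exists>v\<in>q_weight_space l M \<Lambda>. v \<noteq> 0 \<and> (\<forall>i\<le>l. qe M i v = 0))"

definition integrable :: "nat \<Rightarrow> 'v::ab_group_add quantum_module \<Rightarrow> bool" where
  "integrable l M \<longleftrightarrow>
     module.span (qsc M) (\<Union>\<mu>\<in>weight_lattice l. q_weight_space l M \<mu>) = UNIV \<and>
     (\<forall>i\<le>l. \<forall>v. (\<exists>n. (qe M i ^^ n) v = 0) \<and> (\<exists>n. (qf M i ^^ n) v = 0))"


section \<open>Kashiwara operators and crystal bases\<close>

text \<open>
  In an integrable module every u can be written as \<open>\<Sum>\<^sub>n f\<^sub>i\<^sup>(\<^sup>n\<^sup>) u\<^sub>n\<close> where \<open>u\<^sub>n\<close> is a sum of weight vectors
  killed by \<open>e\<^sub>i\<close> whose weights \<open>\<mu>\<close> satisfy \<open>\<langle>\<mu>, \<alpha>\<^sub>i\<^sup>\<vee>\<rangle> \<ge> n\<close>, and the \<open>u\<^sub>n\<close> are unique up to trailing zeros.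
  The bound on n is what makes the decomposition unique: otherwise \<open>f\<^sub>i\<^sup>(\<^sup>n\<^sup>) u\<^sub>n\<close> may vanish for nonzero \<open>u\<^sub>n\<close>.
\<close>

definition string_decomp ::
    "nat \<Rightarrow> 'v::ab_group_add quantum_module \<Rightarrow> nat \<Rightarrow> nat \<Rightarrow> (nat \<Rightarrow> 'v) \<Rightarrow> 'v \<Rightarrow> bool" where
  "string_decomp l M i N c u \<longleftrightarrow>
     (\<forall>n\<le>N. c n \<in> module.span (qsc M)
        {v. \<exists>\<mu>\<in>weight_lattice l. v \<in> q_weight_space l M \<mu> \<and> qe M i v = 0 \<and> int n \<le> hub l \<mu> i}) \<and>
     u = (\<Sum>n\<le>N. divided_power M (qf M i) n (c n))"

definition kashiwara_e :: "nat \<Rightarrow> 'v::ab_group_add quantum_module \<Rightarrow> nat \<Rightarrow> 'v \<Rightarrow> 'v" where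
  "kashiwara_e l M i u =
     (THE u'. \<exists>N c. string_decomp l M i N c u \<and>
                    u' = (\<Sum>n<N. divided_power M (qf M i) n (c (Suc n))))"

definition kashiwara_f :: "nat \<Rightarrow> 'v::ab_group_add quantum_module \<Rightarrow> nat \<Rightarrow> 'v \<Rightarrow> 'v" where
  "kashiwara_f l M i u =
     (THE u'. \<exists>N c. string_decomp l M i N c u \<and>
                    u' = (\<Sum>n\<le>N. divided_power M (qf M i) (Suc n) (c n)))"

text \<open>
  Elements of L/qL are represented as cosets, i.e. as subsets of the module; in particular \<open>qL\<close> itself
  is the zero of L/qL.  \<open>crystal_op M L T\<close> is the map induced on L/qL by a linear T with \<open>T L \<subseteq> L\<close>.
\<close>

definition qL :: "'v quantum_module \<Rightarrow> 'v set \<Rightarrow> 'v set" where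
  "qL M L = qsc M qvar ` L"

definition coset_of :: "'v::ab_group_add quantum_module \<Rightarrow> 'v set \<Rightarrow> 'v \<Rightarrow> 'v set" where
  "coset_of M L u = {u + w | w. w \<in> qL M L}"

definition crystal_op ::
    "'v::ab_group_add quantum_module \<Rightarrow> 'v set \<Rightarrow> ('v \<Rightarrow> 'v) \<Rightarrow> 'v set \<Rightarrow> 'v set" where
  "crystal_op M L T b = (\<Union>u\<in>b. coset_of M L (T u))"

definition crystal_e ::
    "nat \<Rightarrow> 'v::ab_group_add quantum_module \<Rightarrow> 'v set \<Rightarrow> nat \<Rightarrow> 'v set \<Rightarrow> 'v set" where
  "crystal_e l M L i = crystal_op M L (kashiwara_e l M i)"

definition crystal_f ::
    "nat \<Rightarrow> 'v::ab_group_add quantum_module \<Rightarrow> 'v set \<Rightarrow> nat \<Rightarrow> 'v set \<Rightarrow> 'v set" where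
  "crystal_f l M L i = crystal_op M L (kashiwara_f l M i)"

text \<open>
  L is a free module over the local ring with \<open>\<rat>(q) \<otimes> L = M\<close>, that is, some basis X of M over \<open>\<rat>(q)\<close>
  is also a basis of L over the local ring.
\<close>

definition is_lattice :: "'v::ab_group_add quantum_module \<Rightarrow> 'v set \<Rightarrow> bool" where
  "is_lattice M L \<longleftrightarrow>
     (\<exists>X. \<not> module.dependent (qsc M) X \<and> module.span (qsc M) X = UNIV \<and>
          L = {\<Sum>x\<in>S. qsc M (a x) x | S a. finite S \<and> S \<subseteq> X \<and> a ` S \<subseteq> regular_at_0})"

text \<open>B is a basis of the \<open>\<rat>\<close>-vector space L/qL, expressed through coset representatives r.\<close>

definition is_rat_basis :: "'v::ab_group_add quantum_module \<Rightarrow> 'v set \<Rightarrow> 'v set set \<Rightarrow> bool" where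
  "is_rat_basis M L B \<longleftrightarrow>
     B \<subseteq> coset_of M L ` L \<and>
     (\<forall>S c r. finite S \<and> S \<subseteq> B \<and> (\<forall>b\<in>S. r b \<in> b) \<and>
        (\<Sum>b\<in>S. qsc M (Fract [:c b:] 1) (r b)) \<in> qL M L \<longrightarrow> (\<forall>b\<in>S. c b = 0)) \<and>
     (\<forall>u\<in>L. \<exists>S c r. finite S \<and> S \<subseteq> B \<and> (\<forall>b\<in>S. r b \<in> b) \<and>
        u - (\<Sum>b\<in>S. qsc M (Fract [:c b:] 1) (r b)) \<in> qL M L)"

text \<open>
  Kashiwara's (lower) crystal bases (L, B) of an integrable module.  The two conditions following
  \<open>is_rat_basis\<close> are the weight decompositions of L and of B.  A crystal base of \<open>V(\<Lambda>)\<close> exists and is unique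
  up to isomorphism; its second component is the crystal \<open>B(\<Lambda>)\<close>.
\<close>

definition crystal_base ::
    "nat \<Rightarrow> 'v::ab_group_add quantum_module \<Rightarrow> 'v set \<Rightarrow> 'v set set \<Rightarrow> bool" where
  "crystal_base l M L B \<longleftrightarrow>
     integrable l M \<and> is_lattice M L \<and> is_rat_basis M L B \<and>
     (\<forall>u\<in>L. \<exists>S w. finite S \<and> S \<subseteq> weight_lattice l \<and>
        (\<forall>\<mu>\<in>S. w \<mu> \<in> L \<inter> q_weight_space l M \<mu>) \<and> u = (\<Sum>\<mu>\<in>S. w \<mu>)) \<and>
     (\<forall>b\<in>B. \<exists>\<mu>\<in>weight_lattice l. b \<inter> q_weight_space l M \<mu> \<noteq> {}) \<and>
     (\<forall>i\<le>l. kashiwara_e l M i ` L \<subseteq> L \<and> kashiwara_f l M i ` L \<subseteq> L) \<and>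
     (\<forall>i\<le>l. \<forall>b\<in>B. crystal_e l M L i b \<in> insert (qL M L) B \<and>
                    crystal_f l M L i b \<in> insert (qL M L) B) \<and>
     (\<forall>i\<le>l. \<forall>b\<in>B. \<forall>b'\<in>B. b' = crystal_f l M L i b \<longleftrightarrow> b = crystal_e l M L i b')"

definition crystal_wt :: "nat \<Rightarrow> 'v::ab_group_add quantum_module \<Rightarrow> 'v set \<Rightarrow> weight" where
  "crystal_wt l M b = (THE \<mu>. \<mu> \<in> weight_lattice l \<and> b \<inter> q_weight_space l M \<mu> \<noteq> {})"


section \<open>External weights\<close>

definition external_element ::
    "nat \<Rightarrow> 'v::ab_group_add quantum_module \<Rightarrow> 'v set \<Rightarrow> nat \<Rightarrow> 'v set \<Rightarrow> bool" where
  "external_element l M L i b \<longleftrightarrow>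
     (hub l (crystal_wt l M b) i > 0 \<longrightarrow> crystal_e l M L i b = qL M L) \<and>
     (hub l (crystal_wt l M b) i < 0 \<longrightarrow> crystal_f l M L i b = qL M L)"

definition external_weight ::
    "nat \<Rightarrow> 'v::ab_group_add quantum_module \<Rightarrow> 'v set \<Rightarrow> 'v set set \<Rightarrow> nat \<Rightarrow> weight \<Rightarrow> bool" where
  "external_weight l M L B i \<mu> \<longleftrightarrow>
     (\<forall>b\<in>B. crystal_wt l M b = \<mu> \<longrightarrow> external_element l M L i b)"


section \<open>Consistency of the conventions\<close>

lemma hub_eq: "i \<le> l \<Longrightarrow> hub l \<mu> i = fst \<mu> i"
  by (simp add: hub_def pairing_def simple_coroot_def if_distrib of_bool_def cong: if_cong)

lemma hub_simple_root: "i \<le> l \<Longrightarrow> j \<le> l \<Longrightarrow> hub l (simple_root l i) j = cartan l j i"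
  by (simp add: hub_eq simple_root_def)

lemma cyclic_pred:
  assumes "1 \<le> l" "i \<le> l" "k \<le> l"
  shows "i = Suc k mod Suc l \<longleftrightarrow> k = (if i = 0 then l else i - 1)"
    and "k = Suc i mod Suc l \<longleftrightarrow> k = (if i = l then 0 else Suc i)"
  using assms by (auto simp: mod_Suc split: if_splits)

lemma cartan_sum:
  fixes g :: "nat \<Rightarrow> rat"
  assumes "1 \<le> l" "i \<le> l"
  shows "(\<Sum>k\<le>l. of_int (cartan l k i) * g k) =
    2 * g i - g (if i = 0 then l else i - 1) - g (if i = l then 0 else Suc i)"
proof -
  define p s where "p = (if i = 0 then l else i - 1)" and "s = (if i = l then 0 else Suc i)"
  have ps: "p \<le> l" "s \<le> l" using assms by (auto simp: p_def s_def)
  have c: "cartan l k i = 2 * of_bool (k = i) - of_bool (k = p) - of_bool (k = s)" if "k \<le> l" for k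
    using cyclic_pred[OF assms that] unfolding cartan_def p_def s_def by simp
  have "(\<Sum>k\<le>l. of_int (cartan l k i) * g k) =
     (\<Sum>k\<le>l. 2 * (if k = i then g k else 0) - (if k = p then g k else 0) - (if k = s then g k else 0))"
    by (intro sum.cong refl) (simp add: c)
  also have "\<dots> = 2 * g i - g p - g s"
    using assms ps by (simp add: sum_subtractf flip: sum_distrib_left)
  finally show ?thesis unfolding p_def s_def .
qed

lemma wt_form_simple_root:
  assumes l: "1 \<le> l" and i: "i \<le> l"
  shows "wt_form l \<mu> (simple_root l i) = of_int (hub l \<mu> i)"
proof -
  define G :: "nat \<Rightarrow> nat \<Rightarrow> rat"
    where "G j k = of_nat (min j k) - of_nat (j * k) / of_nat (Suc l)" for j k
  have G: "(\<Sum>k\<le>l. of_int (cartan l k i) * G j k) = of_bool (j = i) - of_bool (i = 0)"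
    if jl: "j \<le> l" for j
  proof (subst cartan_sum[OF l i])
    define c :: rat where "c = 1 / of_nat (Suc l)"
    have "c * of_nat (Suc l) = 1" unfolding c_def by (simp del: of_nat_Suc)
    then have c: "of_nat l * c = 1 - c" by (simp add: algebra_simps)
    have jc: "of_nat j * (of_nat l * c) = of_nat j - of_nat j * c" unfolding c by (simp add: algebra_simps)
    have G': "G j k = of_nat (min j k) - of_nat j * of_nat k * c" for k
      by (simp add: G_def c_def)
    consider "i = 0" | "0 < i" "i < l" | "0 < i" "i = l" using i by linarith
    then show "2 * G j i - G j (if i = 0 then l else i - 1) - G j (if i = l then 0 else Suc i)
        = of_bool (j = i) - of_bool (i = 0)"
    proof cases
      case 1
      then show ?thesis using that l jc unfolding G' by (cases "j = 0") (simp_all add: algebra_simps)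
    next
      case 2
      then obtain m where m: "i = Suc m" by (cases i) auto
      consider "j < i" | "j = i" | "j > i" by linarith
      then show ?thesis using 2 unfolding G' m by cases (simp_all add: algebra_simps min_def)
    next
      case 3
      then obtain m where m: "l = Suc m" by (cases l) auto
      have jm: "of_nat j * (of_nat m * c) = of_nat j - 2 * (of_nat j * c)" using jc m by (simp add: algebra_simps)
      consider "j \<le> m" | "j = Suc m" using jl m by linarith
      then show ?thesis using 3 jm unfolding G' m by cases (simp_all add: algebra_simps min_def)
    qed
  qed
  have "(\<Sum>j\<le>l. \<Sum>k\<le>l. of_int (fst \<mu> j) * of_int (fst (simple_root l i) k) * G j k)
      = (\<Sum>j\<le>l. of_int (fst \<mu> j) * (\<Sum>k\<le>l. of_int (cartan l k i) * G j k))"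
    by (simp add: simple_root_def sum_distrib_left mult.assoc)
  also have "\<dots> = (\<Sum>j\<le>l. of_int (fst \<mu> j) * (of_bool (j = i) - of_bool (i = 0)))"
    using G by (intro sum.cong refl) simp
  also have "\<dots> = of_int (fst \<mu> i) - (\<Sum>j\<le>l. of_int (fst \<mu> j)) * of_bool (i = 0)"
  proof -
    have "(\<Sum>j\<le>l. of_int (fst \<mu> j) * (of_bool (j = i) - of_bool (i = 0))) =
      (\<Sum>j\<le>l. (if j = i then of_int (fst \<mu> j) else 0) - of_int (fst \<mu> j) * (of_bool (i = 0) :: rat))"
      by (intro sum.cong refl) (simp add: right_diff_distrib)
    then show ?thesis using i by (simp add: sum_subtractf sum_distrib_right)
  qed
  finally have 1: "(\<Sum>j\<le>l. \<Sum>k\<le>l. of_int (fst \<mu> j) * of_int (fst (simple_root l i) k) * G j k)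
      = of_int (fst \<mu> i) - (\<Sum>j\<le>l. of_int (fst \<mu> j)) * of_bool (i = 0)" .
  have 2: "(\<Sum>k\<le>l. of_int (fst (simple_root l i) k)) = (0::rat)"
    using cartan_sum[OF l i, of "\<lambda>_. 1"] by (simp add: simple_root_def)
  show ?thesis
    unfolding wt_form_def G_def[symmetric] 1 2 using i by (simp add: hub_eq simple_root_def)
qed

lemma sum_fun_eval: "(\<Sum>i\<le>n. f i) x = (\<Sum>i\<le>n. f i x :: int)" for n :: nat
  by (induction n) auto

lemma dominant_weight_eq: "dominant_weight l a = ((\<lambda>j. if j \<le> l then int (a j) else 0), 0)"
proof -
  have 1: "(\<Sum>_<n. fundamental_weight i) = ((\<lambda>j. if j = i then int n else 0), 0)" for n i :: nat
  proof (induction n)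
    case (Suc n)
    show ?case
      unfolding sum.lessThan_Suc Suc.IH by (simp add: fundamental_weight_def fun_eq_iff)
  qed (simp add: zero_prod_def fun_eq_iff)
  show ?thesis
    unfolding dominant_weight_def 1 by (simp add: prod_eq_iff fst_sum snd_sum sum_fun_eval fun_eq_iff)
qed

lemma sum_simple_roots:
  assumes "1 \<le> l"
  shows "(\<Sum>i\<le>l. simple_root l i) = null_root"
proof -
  have sym: "cartan l j i = cartan l i j" for i j
    by (auto simp: cartan_def)
  have "(\<Sum>i\<le>l. if j \<le> l then cartan l j i else 0) = 0" for j
  proof (cases "j \<le> l")
    case True
    have "of_int (\<Sum>i\<le>l. cartan l i j) = (0::rat)"
      using cartan_sum[OF assms True, of "\<lambda>_. 1"] by simp
    then have "(\<Sum>i\<le>l. cartan l i j) = 0" by (simp only: of_int_eq_0_iff)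
    then show ?thesis using True sym by simp
  qed simp
  then show ?thesis
    by (simp add: null_root_def simple_root_def prod_eq_iff fst_sum snd_sum sum_fun_eval fun_eq_iff of_bool_def)
qed

end

theory Submission
  imports Defs
begin

text \<open>
  The defect is nonnegative on every weight of the quantum module, and along an i-string
  \<open>def(\<mu> + k \<alpha>\<^sub>i) = def(\<mu>) - k \<theta>\<^sub>i - k\<^sup>2\<close>.  If \<open>d \<le> \<theta>\<^sub>i\<close>, this is negative for \<open>k = 1\<close>, so \<open>e\<^sub>i\<close> kills the
  weight space of \<open>\<mu>\<close> and a vector u of that space is its own string decomposition.  If \<open>d \<le> -\<theta>\<^sub>i = m\<close>, it is
  negative for \<open>k = -1\<close> and for \<open>k = m + 1\<close>, so u is the bottom \<open>f\<^sub>i\<^sup>(\<^sup>m\<^sup>) v\<close> of a string with \<open>e\<^sub>i v = 0\<close>.  In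
  both cases uniqueness of string decompositions shows that the Kashiwara operator kills u, which
  represents the crystal element.
\<close>

section \<open>Quantum integers\<close>

lemma qvar_power: "qvar ^ n = Fract ([:0, 1:] ^ n) 1"
  by (induction n) (simp_all add: qvar_def One_fract_def)

text \<open>The indeterminate is not a root of unity, by comparing degrees. The nonvanishing of
  quantum integers and the separation of weights by eigenvalues both rest on this.\<close>

lemma qvar_power_eq_1_iff: "qvar ^ n = 1 \<longleftrightarrow> n = 0"
proof
  assume "qvar ^ n = 1"
  then have "[:0, 1:] ^ n = (1 :: rat poly)"
    by (simp add: qvar_power One_fract_def eq_fract)
  then have "degree ([:0, 1:] ^ n :: rat poly) = 0" by simp
  then show "n = 0" by (simp add: degree_power_eq)
qed simp

lemma qvar_nonzero [simp]: "qvar \<noteq> 0"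
  by (simp add: qvar_def Zero_fract_def eq_fract)

lemma qvar_powi_eq_1_iff: "qvar powi n = 1 \<longleftrightarrow> n = 0"
proof (cases "n \<ge> 0")
  case True
  then show ?thesis by (auto simp: power_int_def qvar_power_eq_1_iff)
next
  case False
  then show ?thesis by (auto simp: power_int_def power_inverse qvar_power_eq_1_iff)
qed

lemma qvar_powi_inject [simp]: "qvar powi m = qvar powi n \<longleftrightarrow> m = n"
proof
  assume "qvar powi m = qvar powi n"
  then have "qvar powi (m - n) = 1" by (simp add: power_int_diff)
  then show "m = n" by (simp add: qvar_powi_eq_1_iff)
qed simp

text \<open>Extends \<open>q_int\<close> to all integers, because the eigenvalues met along a string
  have exponents of either sign.\<close>

definition qbracket :: "int \<Rightarrow> ratfun" where
  "qbracket t = (qvar powi t - qvar powi (- t)) / (qvar - inverse qvar)"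

lemma q_int_eq_qbracket: "q_int n = qbracket (int n)"
  by (simp add: q_int_def qbracket_def)

lemma qvar_minus_inverse_nonzero: "qvar - inverse qvar \<noteq> 0"
  using qvar_powi_inject[of 1 "-1"] by (simp add: power_int_minus del: qvar_powi_inject)

lemma qbracket_eq_0_iff: "qbracket t = 0 \<longleftrightarrow> t = 0"
  using qvar_minus_inverse_nonzero by (simp add: qbracket_def)

lemma qbracket_0 [simp]: "qbracket 0 = 0"
  by (simp add: qbracket_eq_0_iff)

lemma qbracket_minus: "qbracket (- t) = - qbracket t"
  by (simp add: qbracket_def minus_divide_left)

lemma q_fact_nonzero: "q_fact n \<noteq> 0"
  by (simp add: q_fact_def q_int_eq_qbracket qbracket_eq_0_iff)

text \<open>After clearing denominators, each product of two brackets becomes a sum of four powers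
  of \<open>qvar\<close>, and the powers cancel. This is the arithmetic behind moving
  \<open>E\<close> past one more \<open>F\<close>.\<close>

lemma qbracket_step:
  "qbracket (n + 1) * qbracket (t - n) = qbracket n * qbracket (t - n + 1) + qbracket (t - 2 * n)"
proof -
  define D where "D = qvar - inverse qvar"
  have D: "D \<noteq> 0" using qvar_minus_inverse_nonzero by (simp add: D_def)
  have prod: "qbracket a * qbracket b * (D * D) =
      qvar powi (a + b) + qvar powi (- a - b) - qvar powi (a - b) - qvar powi (b - a)" for a b
  proof -
    have "qbracket a * qbracket b * (D * D) = (qbracket a * D) * (qbracket b * D)" by simp
    also have "\<dots> = (qvar powi a - qvar powi (- a)) * (qvar powi b - qvar powi (- b))"
      using D by (simp add: qbracket_def D_def[symmetric])
    also have "\<dots> = qvar powi (a + b) + qvar powi (- a + - b) - qvar powi (a + - b) - qvar powi (- a + b)"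
      unfolding power_int_add[OF disjI1[OF qvar_nonzero]] by (simp add: algebra_simps)
    finally show ?thesis by simp
  qed
  \<comment> \<open>Writing the factor 1 as \<open>qbracket 1\<close> turns the single bracket into
    a product as well, so that \<open>prod\<close> applies to all three terms.\<close>
  have one: "qbracket 1 = 1"
    using qvar_minus_inverse_nonzero by (simp add: qbracket_def power_int_minus)
  have "qbracket (n + 1) * qbracket (t - n) * (D * D) =
      (qbracket n * qbracket (t - n + 1) + 1 * qbracket (t - 2 * n)) * (D * D)"
    unfolding distrib_right one[symmetric] prod by (simp add: algebra_simps)
  then show ?thesis using D by simp
qed


section \<open>Highest weight vectors for quantum sl2\<close>

lemma (in vector_space) linear_pow:
  assumes "Vector_Spaces.linear scale scale T"
  shows "Vector_Spaces.linear scale scale (T ^^ n)"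
proof (induction n)
  case (Suc n)
  show ?case using Vector_Spaces.linear_compose[OF Suc assms] by (simp add: o_def)
qed (unfold_locales, simp_all)

text \<open>\<open>W t\<close> stands for the eigenspace of the Cartan element with eigenvalue
  \<open>qvar powi t\<close>. The axioms treat \<open>E\<close> and \<open>F\<close> asymmetrically,
  so the locale can be interpreted twice, with raising and lowering operators in either
  role.\<close>

locale quantum_sl2 = vector_space s
  for s :: "ratfun \<Rightarrow> 'v::ab_group_add \<Rightarrow> 'v" +
  fixes E F :: "'v \<Rightarrow> 'v" and W :: "int \<Rightarrow> 'v set"
  assumes linear_E: "Vector_Spaces.linear s s E"
    and linear_F: "Vector_Spaces.linear s s F"
    and F_W: "v \<in> W t \<Longrightarrow> F v \<in> W (t - 2)"
    and EF: "v \<in> W t \<Longrightarrow> E (F v) = F (E v) + s (qbracket t) v"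
begin

lemma pow_F_W: "v \<in> W t \<Longrightarrow> (F ^^ n) v \<in> W (t - 2 * int n)"
proof (induction n)
  case (Suc n)
  then have "F ((F ^^ n) v) \<in> W (t - 2 * int n - 2)" by (intro F_W)
  then show ?case by (simp add: algebra_simps)
qed simp

text \<open>Induction on n: exchanging \<open>E\<close> with the outermost \<open>F\<close> adds the
  bracket of \<open>t - 2 * n\<close>, which \<open>qbracket_step\<close> absorbs into the
  product.\<close>

lemma E_pow_F:
  assumes "v \<in> W t" "E v = 0"
  shows "E ((F ^^ Suc n) v) = s (qbracket (int n + 1) * qbracket (t - int n)) ((F ^^ n) v)"
proof (induction n)
  case 0
  interpret F: Vector_Spaces.linear s s F by (rule linear_F)
  \<comment> \<open>At n = 0 the first term on the right of \<open>qbracket_step\<close> vanishes,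
    which leaves \<open>qbracket 1 * qbracket t = qbracket t\<close>.\<close>
  show ?case using EF[OF assms(1)] assms(2) qbracket_step[of 0 t] by simp
next
  case (Suc n)
  interpret F: Vector_Spaces.linear s s F by (rule linear_F)
  have "E ((F ^^ Suc (Suc n)) v) =
      F (E ((F ^^ Suc n) v)) + s (qbracket (t - 2 * int (Suc n))) ((F ^^ Suc n) v)"
    using EF[OF pow_F_W[OF assms(1), of "Suc n"]] by simp
  also have "\<dots> = s (qbracket (int n + 1) * qbracket (t - int n) + qbracket (t - 2 * (int n + 1)))
      ((F ^^ Suc n) v)"
    unfolding Suc.IH by (simp add: F.scale scale_left_distrib algebra_simps)
  also have "qbracket (int n + 1) * qbracket (t - int n) + qbracket (t - 2 * (int n + 1)) =
      qbracket (int (Suc n) + 1) * qbracket (t - int (Suc n))"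
    using qbracket_step[of "int n + 1" t] by (simp add: algebra_simps)
  finally show ?case .
qed

text \<open>While n stays at most t, both brackets in \<open>E_pow_F\<close> have positive
  arguments, so \<open>E\<close> recovers a nonzero multiple of the preceding vector.\<close>

lemma pow_F_nonzero:
  assumes "v \<in> W t" "E v = 0" "v \<noteq> 0" "int n \<le> t"
  shows "(F ^^ n) v \<noteq> 0"
  using assms(4)
proof (induction n)
  case (Suc n)
  interpret E: Vector_Spaces.linear s s E by (rule linear_E)
  have "E ((F ^^ Suc n) v) \<noteq> 0"
    unfolding E_pow_F[OF assms(1,2)] using Suc by (simp add: qbracket_eq_0_iff)
  then show ?case using E.zero by metis
qed (simp add: assms)

lemma pow_E_pow_F:
  assumes "v \<in> W t" "E v = 0"
  shows "(E ^^ n) ((F ^^ n) v) = s (\<Prod>k<n. qbracket (int k + 1) * qbracket (t - int k)) v"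
proof (induction n)
  case (Suc n)
  interpret En: Vector_Spaces.linear s s "E ^^ n" by (rule linear_pow[OF linear_E])
  have "(E ^^ Suc n) ((F ^^ Suc n) v) = (E ^^ n) (E ((F ^^ Suc n) v))"
    by (simp add: funpow_swap1)
  then show ?case
    unfolding E_pow_F[OF assms] En.scale Suc.IH by (simp add: mult.commute)
qed simp

text \<open>After n raisings only a multiple of v is left, and the next \<open>E\<close> kills
  it.\<close>

lemma pow_E_pow_F_eq_0:
  assumes "v \<in> W t" "E v = 0" "n < m"
  shows "(E ^^ m) ((F ^^ n) v) = 0"
proof -
  obtain k where m: "m = k + Suc n" using assms(3) by (metis less_iff_Suc_add add.commute add_Suc_right)
  interpret E: Vector_Spaces.linear s s E by (rule linear_E)
  interpret Ek: Vector_Spaces.linear s s "E ^^ k" by (rule linear_pow[OF linear_E])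
  have "(E ^^ Suc n) ((F ^^ n) v) = 0"
    using pow_E_pow_F[OF assms(1,2), of n] assms(2) by (simp add: E.scale)
  then show ?thesis unfolding m funpow_add by (simp add: Ek.zero)
qed

lemma prod_qbracket_nonzero:
  "int n \<le> t \<Longrightarrow> (\<Prod>k<n. qbracket (int k + 1) * qbracket (t - int k)) \<noteq> 0"
  by (auto simp: qbracket_eq_0_iff)

end


section \<open>The weight form\<close>

lemma wt_form_add_right: "wt_form l \<mu> (\<nu> + \<xi>) = wt_form l \<mu> \<nu> + wt_form l \<mu> \<xi>"
  by (simp add: wt_form_def distrib_left distrib_right sum.distrib)

lemma wt_form_commute: "wt_form l \<mu> \<nu> = wt_form l \<nu> \<mu>"
  unfolding wt_form_def
  by (subst sum.swap) (simp add: min.commute mult.commute mult.left_commute)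

lemma wt_form_add_left: "wt_form l (\<mu> + \<nu>) \<xi> = wt_form l \<mu> \<xi> + wt_form l \<nu> \<xi>"
  by (metis wt_form_commute wt_form_add_right)

lemma wt_form_diff_right: "wt_form l \<mu> (\<nu> - \<xi>) = wt_form l \<mu> \<nu> - wt_form l \<mu> \<xi>"
  using wt_form_add_right[of l \<mu> "\<nu> - \<xi>" \<xi>] by simp

section \<open>Root strings and the defect along them\<close>

lemma cartan_diag: "1 \<le> l \<Longrightarrow> i \<le> l \<Longrightarrow> cartan l i i = 2"
  by (auto simp: cartan_def mod_Suc split: if_splits)

text \<open>The multiple \<open>k \<alpha>\<^sub>i\<close> for an integer k of either sign, so that
  both directions of an i-string are handled by the same formulas.\<close>

definition root_shift :: "nat \<Rightarrow> nat \<Rightarrow> int \<Rightarrow> weight" where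
  "root_shift l i k = ((\<lambda>j. k * fst (simple_root l i) j), k * snd (simple_root l i))"

lemma root_shift_0 [simp]: "root_shift l i 0 = 0"
  by (simp add: root_shift_def prod_eq_iff fun_eq_iff)

lemma root_shift_1 [simp]: "root_shift l i 1 = simple_root l i"
  by (simp add: root_shift_def)

lemma root_shift_add: "root_shift l i (j + k) = root_shift l i j + root_shift l i k"
  by (simp add: root_shift_def prod_eq_iff fun_eq_iff algebra_simps)

lemma root_shift_in_weight_lattice [simp]: "root_shift l i k \<in> weight_lattice l"
  by (simp add: root_shift_def weight_lattice_def simple_root_def)

lemma simple_root_in_weight_lattice [simp]: "simple_root l i \<in> weight_lattice l"
  by (simp add: weight_lattice_def simple_root_def)

lemma weight_lattice_add: "\<mu> \<in> weight_lattice l \<Longrightarrow> \<nu> \<in> weight_lattice l \<Longrightarrow> \<mu> + \<nu> \<in> weight_lattice l"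
  by (simp add: weight_lattice_def)

lemma weight_lattice_diff: "\<mu> \<in> weight_lattice l \<Longrightarrow> \<nu> \<in> weight_lattice l \<Longrightarrow> \<mu> - \<nu> \<in> weight_lattice l"
  by (simp add: weight_lattice_def)

lemma wt_form_root_shift:
  assumes "1 \<le> l" "i \<le> l"
  shows "wt_form l \<mu> (root_shift l i k) = of_int (k * hub l \<mu> i)"
proof -
  have "wt_form l \<mu> (root_shift l i k) = of_int k * wt_form l \<mu> (simple_root l i)"
    by (simp add: wt_form_def root_shift_def sum_distrib_left algebra_simps)
  then show ?thesis using wt_form_simple_root[OF assms] by simp
qed

lemma hub_root_shift:
  assumes "1 \<le> l" "i \<le> l"
  shows "hub l (\<mu> + root_shift l i k) i = hub l \<mu> i + 2 * k"
  using assms cartan_diag[OF assms] by (simp add: hub_eq root_shift_def simple_root_def)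

lemma defect_root_shift:
  assumes "1 \<le> l" "i \<le> l"
  shows "defect l \<Lambda> (\<mu> + root_shift l i k) = defect l \<Lambda> \<mu> - of_int (k * hub l \<mu> i + k * k)"
proof -
  \<comment> \<open>The expansion is grouped so that every isolated root shift stands on the right,
    where \<open>wt_form_root_shift\<close> turns it into a hub entry.\<close>
  have "wt_form l (\<mu> + root_shift l i k) (\<mu> + root_shift l i k) =
      wt_form l \<mu> \<mu> + wt_form l \<mu> (root_shift l i k) + wt_form l (\<mu> + root_shift l i k) (root_shift l i k)"
    using wt_form_add_right wt_form_add_left wt_form_commute by metis
  then show ?thesis
    unfolding wt_form_root_shift[OF assms] hub_root_shift[OF assms]
    by (simp add: defect_def field_simps)
qed

text \<open>A difference of squares for a symmetric form. It exposes the sign of the defect once the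
  left factor is dominant and the right one lies in \<open>root_cone\<close>.\<close>

lemma defect_eq: "2 * defect l \<Lambda> \<mu> = wt_form l (\<Lambda> + \<mu>) (\<Lambda> - \<mu>)"
  by (simp add: defect_def wt_form_add_left wt_form_diff_right wt_form_commute[of l \<mu> \<Lambda>])

text \<open>This is \<open>Q_+\<close>, generated one simple root at a time, in step with successive
  applications of the operators \<open>qf\<close>.\<close>

inductive_set root_cone :: "nat \<Rightarrow> weight set" for l where
  zero: "0 \<in> root_cone l"
| add: "\<beta> \<in> root_cone l \<Longrightarrow> i \<le> l \<Longrightarrow> \<beta> + simple_root l i \<in> root_cone l"

lemma root_cone_subset_weight_lattice: "\<beta> \<in> root_cone l \<Longrightarrow> \<beta> \<in> weight_lattice l"
  by (induction rule: root_cone.induct) (auto simp: weight_lattice_add, simp add: weight_lattice_def)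

text \<open>Each simple root added to the cone element contributes one hub entry of \<xi>. It serves
  both for a dominant \<xi> and for the Weyl vector.\<close>

lemma wt_form_root_cone_nonneg:
  assumes "\<beta> \<in> root_cone l" "1 \<le> l" "\<And>i. i \<le> l \<Longrightarrow> hub l \<xi> i \<ge> 0"
  shows "wt_form l \<xi> \<beta> \<ge> 0"
  using assms(1)
proof induction
  case zero
  show ?case by (simp add: wt_form_def)
next
  case (add \<beta> i)
  then show ?case using assms(2,3) by (simp add: wt_form_add_right wt_form_simple_root)
qed

text \<open>It pairs to 1 with every simple root, so on \<open>root_cone\<close> the form against it
  is the height.\<close>

definition weyl_vector :: "nat \<Rightarrow> weight" where
  "weyl_vector l = ((\<lambda>j. of_bool (j \<le> l)), 0)"

lemma hub_weyl_vector: "i \<le> l \<Longrightarrow> hub l (weyl_vector l) i = 1"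
  by (simp add: hub_eq weyl_vector_def)

lemma pairing_add_left: "pairing l (\<mu> + \<nu>) h = pairing l \<mu> h + pairing l \<nu> h"
  by (simp add: pairing_def sum.distrib algebra_simps)

lemma pairing_diff_left: "pairing l (\<mu> - \<nu>) h = pairing l \<mu> h - pairing l \<nu> h"
  using pairing_add_left[of l "\<mu> - \<nu>" \<nu> h] by simp

lemma pairing_uminus_right: "pairing l \<mu> (- h) = - pairing l \<mu> h"
  by (simp add: pairing_def sum_negf)

text \<open>Coroots read off the entries up to l and the scaling element reads off the coefficient
  of \<delta>; the lattice condition fixes the remaining entries.\<close>

lemma weight_eqI:
  assumes "\<mu> \<in> weight_lattice l" "\<nu> \<in> weight_lattice l"
    and "\<And>h. h \<in> coweight_lattice l \<Longrightarrow> pairing l \<mu> h = pairing l \<nu> h"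
  shows "\<mu> = \<nu>"
proof -
  have "fst \<mu> j = fst \<nu> j" for j
  proof (cases "j \<le> l")
    case True
    then have "simple_coroot j \<in> coweight_lattice l"
      by (simp add: coweight_lattice_def simple_coroot_def)
    from assms(3)[OF this] show ?thesis using hub_eq[OF True] by (simp add: hub_def)
  qed (use assms(1,2) in \<open>simp add: weight_lattice_def\<close>)
  moreover have "scaling_element \<in> coweight_lattice l"
    by (simp add: coweight_lattice_def scaling_element_def)
  from assms(3)[OF this] have "snd \<mu> = snd \<nu>" by (simp add: pairing_def scaling_element_def)
  ultimately show ?thesis by (simp add: prod_eq_iff fun_eq_iff)
qed


section \<open>Weight spaces\<close>

lemma (in vector_space) span_UN_subspaces:
  assumes "x \<in> span (\<Union>\<mu>\<in>I. U \<mu>)" "\<And>\<mu>. subspace (U \<mu>)"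
  obtains S w where "finite S" "S \<subseteq> I" "\<And>\<mu>. \<mu> \<in> S \<Longrightarrow> w \<mu> \<in> U \<mu>" "x = (\<Sum>\<mu>\<in>S. w \<mu>)"
proof -
  have "\<exists>S w. finite S \<and> S \<subseteq> I \<and> (\<forall>\<mu>\<in>S. w \<mu> \<in> U \<mu>) \<and> x = (\<Sum>\<mu>\<in>S. w \<mu>)"
    using assms(1)
  proof (induction rule: span_induct_alt)
    case base
    show ?case by (intro exI[of _ "{}"]) auto
  next
    case (step c x y)
    then obtain S w \<nu> where S: "finite S" "S \<subseteq> I" "\<forall>\<mu>\<in>S. w \<mu> \<in> U \<mu>" "y = (\<Sum>\<mu>\<in>S. w \<mu>)"
      and \<nu>: "\<nu> \<in> I" "x \<in> U \<nu>" by blast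
    \<comment> \<open>The two contributions are guarded separately because \<nu> may or may not
      already lie in \<open>S\<close>.\<close>
    define w' where "w' \<mu> = (if \<mu> = \<nu> then scale c x else 0) + (if \<mu> \<in> S then w \<mu> else 0)" for \<mu>
    have "(\<Sum>\<mu>\<in>insert \<nu> S. if \<mu> \<in> S then w \<mu> else 0) = (\<Sum>\<mu>\<in>S. w \<mu>)"
      using S(1) by (intro sum.mono_neutral_cong_right) auto
    then have "scale c x + y = (\<Sum>\<mu>\<in>insert \<nu> S. w' \<mu>)"
      using S(1,4) by (simp add: w'_def sum.distrib del: sum.insert)
    moreover have "\<forall>\<mu>\<in>insert \<nu> S. w' \<mu> \<in> U \<mu>"
      using S(3) \<nu>(2) assms(2) by (auto simp: w'_def subspace_add subspace_scale)
    ultimately show ?case using S(1,2) \<nu>(1) by (intro exI[of _ "insert \<nu> S"]) auto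
  qed
  then show thesis using that by blast
qed

locale quantum_affine =
  fixes l :: nat and M :: "'v::ab_group_add quantum_module"
  assumes rank: "1 \<le> l" and quantum_module: "is_quantum_module l M"
begin

sublocale vector_space "qsc M"
  using quantum_module by (simp add: is_quantum_module_def)

lemma linear_qe: "i \<le> l \<Longrightarrow> Vector_Spaces.linear (qsc M) (qsc M) (qe M i)"
  and linear_qf: "i \<le> l \<Longrightarrow> Vector_Spaces.linear (qsc M) (qsc M) (qf M i)"
  and linear_qk: "h \<in> coweight_lattice l \<Longrightarrow> Vector_Spaces.linear (qsc M) (qsc M) (qk M h)"
  using quantum_module by (auto simp: is_quantum_module_def quantum_ops_def)

lemma coweight_uminus: "h \<in> coweight_lattice l \<Longrightarrow> - h \<in> coweight_lattice l"
  by (simp add: coweight_lattice_def)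

lemma coroot_in_coweight_lattice: "i \<le> l \<Longrightarrow> simple_coroot i \<in> coweight_lattice l"
  by (simp add: coweight_lattice_def simple_coroot_def)

lemma qk_uminus_qk:
  assumes "h \<in> coweight_lattice l"
  shows "qk M (- h) (qk M h v) = v"
proof -
  have "qk M (- h + h) = qk M (- h) \<circ> qk M h" "qk M 0 = id"
    using quantum_module assms coweight_uminus[OF assms] unfolding is_quantum_module_def by blast+
  then show ?thesis by (simp add: fun_eq_iff)
qed

lemma qk_qe:
  assumes "h \<in> coweight_lattice l" "i \<le> l"
  shows "qk M h (qe M i v) = qsc M (qvar powi pairing l (simple_root l i) h) (qe M i (qk M h v))"
proof -
  have "qk M h (qe M i (qk M (- h) v)) = qsc M (qvar powi pairing l (simple_root l i) h) (qe M i v)" for v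
    using quantum_module assms unfolding is_quantum_module_def by blast
  from this[of "qk M h v"] show ?thesis using assms by (simp add: qk_uminus_qk)
qed

lemma qk_qf:
  assumes "h \<in> coweight_lattice l" "i \<le> l"
  shows "qk M h (qf M i v) = qsc M (qvar powi (- pairing l (simple_root l i) h)) (qf M i (qk M h v))"
proof -
  have "qk M h (qf M i (qk M (- h) v)) = qsc M (qvar powi (- pairing l (simple_root l i) h)) (qf M i v)" for v
    using quantum_module assms unfolding is_quantum_module_def by blast
  from this[of "qk M h v"] show ?thesis using assms by (simp add: qk_uminus_qk)
qed

lemma qe_qf:
  assumes "i \<le> l" "j \<le> l"
  shows "qe M i (qf M j v) = qf M j (qe M i v) + (if i = j then qsc M (inverse (qvar - inverse qvar))
           (qk M (simple_coroot i) v - qk M (- simple_coroot i) v) else 0)"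
proof -
  have "commutator (qe M i) (qf M j) v = (if i = j then qsc M (inverse (qvar - inverse qvar))
           (qk M (simple_coroot i) v - qk M (- simple_coroot i) v) else 0)"
    using quantum_module assms unfolding is_quantum_module_def by blast
  then show ?thesis unfolding commutator_def by (simp add: algebra_simps)
qed

lemma subspace_weight_space: "subspace (q_weight_space l M \<mu>)"
proof (rule subspaceI)
  show "0 \<in> q_weight_space l M \<mu>"
    unfolding q_weight_space_def
  proof (intro CollectI ballI)
    fix h assume "h \<in> coweight_lattice l"
    then interpret K: Vector_Spaces.linear "qsc M" "qsc M" "qk M h" by (rule linear_qk)
    show "qk M h 0 = qsc M (qvar powi pairing l \<mu> h) 0" by (simp add: K.zero)
  qed
  show "x + y \<in> q_weight_space l M \<mu>" if "x \<in> q_weight_space l M \<mu>" "y \<in> q_weight_space l M \<mu>" for x y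
    using that linear_qk by (auto simp: q_weight_space_def Vector_Spaces.linear_iff scale_right_distrib)
  show "qsc M c x \<in> q_weight_space l M \<mu>" if "x \<in> q_weight_space l M \<mu>" for c x
    using that linear_qk by (auto simp: q_weight_space_def Vector_Spaces.linear_iff mult.commute)
qed

text \<open>For each \<mu> in \<open>S\<close> some coweight h separates it from the inserted \<nu>.
  Applying \<open>qk M h\<close> minus its eigenvalue at \<nu> removes the \<nu>-summand and leaves
  a relation over \<open>S\<close>, in which the factor at \<mu> is nonzero.\<close>

lemma weight_vectors_independent:
  assumes "finite S" "S \<subseteq> weight_lattice l" "\<And>\<mu>. \<mu> \<in> S \<Longrightarrow> w \<mu> \<in> q_weight_space l M \<mu>"
    and "(\<Sum>\<mu>\<in>S. w \<mu>) = 0" "\<mu> \<in> S"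
  shows "w \<mu> = 0"
  using assms
proof (induction S arbitrary: w \<mu> rule: finite_induct)
  case (insert \<nu> S)
  have vanish: "w \<mu> = 0" if "\<mu> \<in> S" for \<mu>
  proof (rule ccontr)
    assume "w \<mu> \<noteq> 0"
    have "\<mu> \<noteq> \<nu>" using that insert.hyps by auto
    moreover have "\<mu> \<in> weight_lattice l" "\<nu> \<in> weight_lattice l" using insert.prems(1) that by auto
    ultimately obtain h where h: "h \<in> coweight_lattice l" "pairing l \<mu> h \<noteq> pairing l \<nu> h"
      using weight_eqI by metis
    interpret K: Vector_Spaces.linear "qsc M" "qsc M" "qk M h" by (rule linear_qk[OF h(1)])
    define w' where "w' \<mu> = qsc M (qvar powi pairing l \<mu> h - qvar powi pairing l \<nu> h) (w \<mu>)" for \<mu>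
    have w': "w' \<mu> = qk M h (w \<mu>) - qsc M (qvar powi pairing l \<nu> h) (w \<mu>)" if "\<mu> \<in> insert \<nu> S" for \<mu>
      using insert.prems(2)[OF that] h(1) by (simp add: w'_def q_weight_space_def scale_left_diff_distrib)
    have "(\<Sum>\<mu>\<in>insert \<nu> S. w' \<mu>) = (\<Sum>\<mu>\<in>insert \<nu> S. qk M h (w \<mu>) - qsc M (qvar powi pairing l \<nu> h) (w \<mu>))"
      by (rule sum.cong[OF refl w'])
    also have "\<dots> = qk M h (\<Sum>\<mu>\<in>insert \<nu> S. w \<mu>) - qsc M (qvar powi pairing l \<nu> h) (\<Sum>\<mu>\<in>insert \<nu> S. w \<mu>)"
      unfolding K.sum scale_sum_right by (rule sum_subtractf)
    also have "\<dots> = 0" unfolding insert.prems(3) by (simp add: K.zero)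
    finally have "(\<Sum>\<mu>\<in>S. w' \<mu>) = 0" using insert.hyps by (simp add: w'_def)
    moreover have "S \<subseteq> weight_lattice l" using insert.prems(1) by simp
    moreover have "w' \<nu> \<in> q_weight_space l M \<nu>" if "\<nu> \<in> S" for \<nu>
      using insert.prems(2)[of \<nu>] that
      by (auto simp only: w'_def insert_iff intro: subspace_scale[OF subspace_weight_space])
    ultimately have "w' \<mu> = 0" using insert.IH that by blast
    then show False using h(2) \<open>w \<mu> \<noteq> 0\<close> by (simp add: w'_def)
  qed
  then have "(\<Sum>\<mu>\<in>S. w \<mu>) = 0" by simp
  then have "w \<nu> = 0" using insert.prems(3) insert.hyps by simp
  then show ?case using vanish insert.prems(4) by blast
qed simp

section \<open>Action of the generators on weight spaces and on eigenspaces of a coroot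
  element\<close>

lemma qe_weight:
  assumes "v \<in> q_weight_space l M \<mu>" "i \<le> l"
  shows "qe M i v \<in> q_weight_space l M (\<mu> + simple_root l i)"
proof -
  interpret E: Vector_Spaces.linear "qsc M" "qsc M" "qe M i" by (rule linear_qe[OF assms(2)])
  show ?thesis using assms
    by (auto simp: q_weight_space_def qk_qe E.scale pairing_add_left power_int_add mult.commute)
qed

lemma qf_weight:
  assumes "v \<in> q_weight_space l M \<mu>" "i \<le> l"
  shows "qf M i v \<in> q_weight_space l M (\<mu> - simple_root l i)"
proof -
  interpret F: Vector_Spaces.linear "qsc M" "qsc M" "qf M i" by (rule linear_qf[OF assms(2)])
  show ?thesis using assms
    by (auto simp: q_weight_space_def qk_qf F.scale pairing_diff_left simp flip: power_int_add)
qed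

lemma pow_qe_weight:
  assumes "v \<in> q_weight_space l M \<mu>" "i \<le> l"
  shows "(qe M i ^^ n) v \<in> q_weight_space l M (\<mu> + root_shift l i (int n))"
proof (induction n)
  case (Suc n)
  show ?case
    using qe_weight[OF Suc assms(2)] root_shift_add[of l i "int n" 1] by (simp add: add.assoc add.commute[of 1])
qed (simp add: assms)

lemma pow_qf_weight:
  assumes "v \<in> q_weight_space l M \<mu>" "i \<le> l"
  shows "(qf M i ^^ n) v \<in> q_weight_space l M (\<mu> + root_shift l i (- int n))"
proof (induction n)
  case (Suc n)
  have "root_shift l i (- int n) = root_shift l i (- int (Suc n)) + root_shift l i 1"
    unfolding root_shift_add[symmetric] by simp
  then show ?case
    using qf_weight[OF Suc assms(2)] by (simp add: add.assoc[symmetric])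
qed (simp add: assms)

text \<open>Only the hub entry at i is recorded, not the whole weight. Both signs of the coroot
  appear because both occur in the commutator of \<open>qe\<close> and \<open>qf\<close>.\<close>

definition K_eigenspace :: "nat \<Rightarrow> int \<Rightarrow> 'v set" where
  "K_eigenspace i t = {v. qk M (simple_coroot i) v = qsc M (qvar powi t) v \<and>
                          qk M (- simple_coroot i) v = qsc M (qvar powi (- t)) v}"

lemma weight_space_subset_K_eigenspace:
  "i \<le> l \<Longrightarrow> v \<in> q_weight_space l M \<mu> \<Longrightarrow> v \<in> K_eigenspace i (hub l \<mu> i)"
  using coroot_in_coweight_lattice coweight_uminus
  by (auto simp: q_weight_space_def K_eigenspace_def hub_def pairing_uminus_right)

lemma qe_qf_eigen:
  assumes "v \<in> K_eigenspace i t" "i \<le> l"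
  shows "qe M i (qf M i v) = qf M i (qe M i v) + qsc M (qbracket t) v"
  using assms by (simp add: qe_qf K_eigenspace_def qbracket_def divide_inverse mult.commute
    flip: scale_left_diff_distrib)

lemma pairing_root_coroot: "i \<le> l \<Longrightarrow> pairing l (simple_root l i) (simple_coroot i) = 2"
  using hub_simple_root cartan_diag rank by (simp add: hub_def)

lemma scale_powi: "qsc M (qvar powi a) (qsc M (qvar powi b) v) = qsc M (qvar powi (a + b)) v"
  by (simp add: power_int_add)

lemma qf_K_eigenspace:
  assumes "i \<le> l" "v \<in> K_eigenspace i t"
  shows "qf M i v \<in> K_eigenspace i (t - 2)"
proof -
  interpret F: Vector_Spaces.linear "qsc M" "qsc M" "qf M i" by (rule linear_qf[OF assms(1)])
  note c = coroot_in_coweight_lattice[OF assms(1)]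
  have "qk M (simple_coroot i) v = qsc M (qvar powi t) v"
    "qk M (- simple_coroot i) v = qsc M (qvar powi (- t)) v"
    using assms(2) by (simp_all add: K_eigenspace_def)
  then show ?thesis
    unfolding K_eigenspace_def mem_Collect_eq qk_qf[OF c assms(1)]
      qk_qf[OF coweight_uminus[OF c] assms(1)] pairing_uminus_right pairing_root_coroot[OF assms(1)]
    by (simp only: F.scale scale_powi) simp
qed

lemma qe_K_eigenspace:
  assumes "i \<le> l" "v \<in> K_eigenspace i t"
  shows "qe M i v \<in> K_eigenspace i (t + 2)"
proof -
  interpret E: Vector_Spaces.linear "qsc M" "qsc M" "qe M i" by (rule linear_qe[OF assms(1)])
  note c = coroot_in_coweight_lattice[OF assms(1)]
  have "qk M (simple_coroot i) v = qsc M (qvar powi t) v"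
    "qk M (- simple_coroot i) v = qsc M (qvar powi (- t)) v"
    using assms(2) by (simp_all add: K_eigenspace_def)
  then show ?thesis
    unfolding K_eigenspace_def mem_Collect_eq qk_qe[OF c assms(1)]
      qk_qe[OF coweight_uminus[OF c] assms(1)] pairing_uminus_right pairing_root_coroot[OF assms(1)]
    by (simp only: E.scale scale_powi) (simp add: add.commute)
qed

lemma quantum_sl2_ef:
  assumes "i \<le> l"
  shows "quantum_sl2 (qsc M) (qe M i) (qf M i) (K_eigenspace i)"
proof unfold_locales
  fix v t assume v: "v \<in> K_eigenspace i t"
  show "qf M i v \<in> K_eigenspace i (t - 2)" by (rule qf_K_eigenspace[OF assms v])
  show "qe M i (qf M i v) = qf M i (qe M i v) + qsc M (qbracket t) v" by (rule qe_qf_eigen[OF v assms])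
qed (use linear_qe[OF assms] linear_qf[OF assms] in \<open>simp_all add: Vector_Spaces.linear_iff\<close>)

text \<open>Exchanging the two operators changes the sign of the commutator; this is matched by
  reversing the eigenvalue exponent, since \<open>qbracket\<close> is odd.\<close>

lemma quantum_sl2_fe:
  assumes "i \<le> l"
  shows "quantum_sl2 (qsc M) (qf M i) (qe M i) (\<lambda>t. K_eigenspace i (- t))"
proof unfold_locales
  fix v t assume v: "v \<in> K_eigenspace i (- t)"
  show "qe M i v \<in> K_eigenspace i (- (t - 2))"
    using qe_K_eigenspace[OF assms v] by simp
  show "qf M i (qe M i v) = qe M i (qf M i v) + qsc M (qbracket t) v"
    using qe_qf_eigen[OF v assms] by (simp add: qbracket_minus)
qed (use linear_qe[OF assms] linear_qf[OF assms] in \<open>simp_all add: Vector_Spaces.linear_iff\<close>)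


text \<open>
  Lowering x to the bottom of its i-string and then raising from there reaches the reflected weight.
\<close>

lemma reflected_weight_vector:
  assumes i: "i \<le> l" and x: "x \<in> q_weight_space l M \<nu>" "x \<noteq> 0"
    and nilpotent: "(qf M i ^^ n) x = 0" and neg: "hub l \<nu> i < 0"
  obtains y where "y \<in> q_weight_space l M (\<nu> + root_shift l i (- hub l \<nu> i))" "y \<noteq> 0"
proof -
  interpret fe: quantum_sl2 "qsc M" "qf M i" "qe M i" "\<lambda>t. K_eigenspace i (- t)"
    by (rule quantum_sl2_fe[OF i])
  obtain j where j: "(qf M i ^^ j) x \<noteq> 0" "(qf M i ^^ Suc j) x = 0"
    using nilpotent x(2) by (induction n) auto
  define u where "u = (qf M i ^^ j) x"
  have u: "u \<in> q_weight_space l M (\<nu> + root_shift l i (- int j))"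
    unfolding u_def by (rule pow_qf_weight[OF x(1) i])
  define t where "t = - hub l \<nu> i + 2 * int j"
  have "u \<in> K_eigenspace i (- t)"
    using weight_space_subset_K_eigenspace[OF i u] by (simp add: hub_root_shift[OF rank i] t_def)
  \<comment> \<open>The first j raisings undo the lowering and the others climb to the reflected
    weight. Here \<open>t\<close> is the negated hub entry of \<open>u\<close> and n is at most t,
    so the string has not ended yet.\<close>
  moreover define n where "n = j + nat (- hub l \<nu> i)"
  ultimately have "(qe M i ^^ n) u \<noteq> 0"
    using j neg by (intro fe.pow_F_nonzero[of u t n]) (auto simp: u_def t_def)
  moreover have "\<nu> + root_shift l i (- int j) + root_shift l i (int n) = \<nu> + root_shift l i (- hub l \<nu> i)"
    unfolding add.assoc root_shift_add[symmetric] using neg by (simp add: n_def)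
  then have "(qe M i ^^ n) u \<in> q_weight_space l M (\<nu> + root_shift l i (- hub l \<nu> i))"
    using pow_qe_weight[OF u i, of n] by (simp only:)
  ultimately show thesis using that by blast
qed


subsection \<open>Uniqueness of string decompositions\<close>

definition string_heads :: "nat \<Rightarrow> nat \<Rightarrow> 'v set" where
  "string_heads i n =
     {v. \<exists>\<mu>\<in>weight_lattice l. v \<in> q_weight_space l M \<mu> \<and> qe M i v = 0 \<and> int n \<le> hub l \<mu> i}"

text \<open>Grouped by weight, the heads form a union of subspaces, so a vector of their span splits
  into one head per weight.\<close>

lemma string_heads_decomp:
  assumes "i \<le> l" "x \<in> span (string_heads i n)"
  obtains S w where "finite S" "S \<subseteq> weight_lattice l" "x = (\<Sum>\<mu>\<in>S. w \<mu>)"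
    "\<And>\<mu>. \<mu> \<in> S \<Longrightarrow> w \<mu> \<in> q_weight_space l M \<mu>" "\<And>\<mu>. \<mu> \<in> S \<Longrightarrow> qe M i (w \<mu>) = 0"
    "\<And>\<mu>. \<mu> \<in> S \<Longrightarrow> int n \<le> hub l \<mu> i"
proof -
  interpret E: Vector_Spaces.linear "qsc M" "qsc M" "qe M i" by (rule linear_qe[OF assms(1)])
  define I where "I = {\<mu>\<in>weight_lattice l. int n \<le> hub l \<mu> i}"
  define U where "U \<mu> = q_weight_space l M \<mu> \<inter> {v. qe M i v = 0}" for \<mu>
  have "string_heads i n = (\<Union>\<mu>\<in>I. U \<mu>)" by (auto simp: string_heads_def I_def U_def)
  moreover have "subspace (U \<mu>)" for \<mu>
    unfolding U_def by (intro subspace_inter subspace_weight_space E.subspace_kernel)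
  ultimately obtain S w where "finite S" "S \<subseteq> I" "\<And>\<mu>. \<mu> \<in> S \<Longrightarrow> w \<mu> \<in> U \<mu>" "x = (\<Sum>\<mu>\<in>S. w \<mu>)"
    using span_UN_subspaces assms(2) by metis
  then show thesis by (intro that) (auto simp: I_def U_def)
qed

text \<open>Lowering and then raising n times multiplies each weight component by a scalar that is
  nonzero because n is at most the hub entry. Components of different weights cannot cancel.\<close>

lemma string_head_eq_0:
  assumes i: "i \<le> l" and x: "x \<in> span (string_heads i n)"
    and zero: "(qe M i ^^ n) ((qf M i ^^ n) x) = 0"
  shows "x = 0"
proof -
  interpret ef: quantum_sl2 "qsc M" "qe M i" "qf M i" "K_eigenspace i" by (rule quantum_sl2_ef[OF i])
  interpret En: Vector_Spaces.linear "qsc M" "qsc M" "qe M i ^^ n" by (rule linear_pow[OF linear_qe[OF i]])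
  interpret Fn: Vector_Spaces.linear "qsc M" "qsc M" "qf M i ^^ n" by (rule linear_pow[OF linear_qf[OF i]])
  obtain S w where S: "finite S" "S \<subseteq> weight_lattice l" "x = (\<Sum>\<mu>\<in>S. w \<mu>)"
    "\<And>\<mu>. \<mu> \<in> S \<Longrightarrow> w \<mu> \<in> q_weight_space l M \<mu>" "\<And>\<mu>. \<mu> \<in> S \<Longrightarrow> qe M i (w \<mu>) = 0"
    "\<And>\<mu>. \<mu> \<in> S \<Longrightarrow> int n \<le> hub l \<mu> i"
    by (rule string_heads_decomp[OF i x]) blast
  define r where "r \<mu> = (\<Prod>k<n. qbracket (int k + 1) * qbracket (hub l \<mu> i - int k))" for \<mu>
  have "(\<Sum>\<mu>\<in>S. qsc M (r \<mu>) (w \<mu>)) = (\<Sum>\<mu>\<in>S. (qe M i ^^ n) ((qf M i ^^ n) (w \<mu>)))"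
    using ef.pow_E_pow_F[OF weight_space_subset_K_eigenspace[OF i S(4)] S(5)]
    by (intro sum.cong) (auto simp: r_def)
  also have "\<dots> = 0" using zero unfolding S(3) Fn.sum En.sum .
  finally have sum_0: "(\<Sum>\<mu>\<in>S. qsc M (r \<mu>) (w \<mu>)) = 0" .
  have "w \<mu> = 0" if "\<mu> \<in> S" for \<mu>
  proof -
    have "qsc M (r \<mu>) (w \<mu>) = 0"
      using weight_vectors_independent[OF S(1,2) subspace_scale[OF subspace_weight_space S(4)] sum_0 that]
      by blast
    moreover have "r \<mu> \<noteq> 0" unfolding r_def by (rule ef.prod_qbracket_nonzero[OF S(6)[OF that]])
    ultimately show ?thesis by simp
  qed
  then show ?thesis using S(3) by simp
qed

lemma pow_qe_pow_qf_string_head: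
  assumes i: "i \<le> l" and x: "x \<in> span (string_heads i n)" and m: "n < m"
  shows "(qe M i ^^ m) ((qf M i ^^ n) x) = 0"
proof -
  interpret ef: quantum_sl2 "qsc M" "qe M i" "qf M i" "K_eigenspace i" by (rule quantum_sl2_ef[OF i])
  interpret En: Vector_Spaces.linear "qsc M" "qsc M" "qe M i ^^ m" by (rule linear_pow[OF linear_qe[OF i]])
  interpret Fn: Vector_Spaces.linear "qsc M" "qsc M" "qf M i ^^ n" by (rule linear_pow[OF linear_qf[OF i]])
  obtain S w where S: "finite S" "S \<subseteq> weight_lattice l" "x = (\<Sum>\<mu>\<in>S. w \<mu>)"
    "\<And>\<mu>. \<mu> \<in> S \<Longrightarrow> w \<mu> \<in> q_weight_space l M \<mu>" "\<And>\<mu>. \<mu> \<in> S \<Longrightarrow> qe M i (w \<mu>) = 0"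
    by (rule string_heads_decomp[OF i x]) blast
  show ?thesis
    unfolding S(3) Fn.sum En.sum
    using ef.pow_E_pow_F_eq_0[OF weight_space_subset_K_eigenspace[OF i S(4)] S(5) m]
    by (intro sum.neutral) blast
qed

lemma string_decomp_iff:
  "string_decomp l M i N c u \<longleftrightarrow>
     (\<forall>n\<le>N. c n \<in> span (string_heads i n)) \<and> u = (\<Sum>n\<le>N. divided_power M (qf M i) n (c n))"
  by (simp add: string_decomp_def string_heads_def)

lemma divided_power_linear:
  assumes "i \<le> l"
  shows "Vector_Spaces.linear (qsc M) (qsc M) (divided_power M (qf M i) n)"
proof -
  interpret Fn: Vector_Spaces.linear "qsc M" "qsc M" "qf M i ^^ n" by (rule linear_pow[OF linear_qf[OF assms]])
  show ?thesis
    by unfold_locales (simp_all add: divided_power_def Fn.add Fn.scale scale_right_distrib mult.commute)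
qed

text \<open>Induction on the length: raising as often as the top index kills all shorter terms and
  isolates the top coefficient, which vanishes by \<open>string_head_eq_0\<close>.\<close>

lemma string_decomp_0:
  assumes i: "i \<le> l" and "string_decomp l M i N c 0" "n \<le> N"
  shows "c n = 0"
  using assms(2,3)
proof (induction N arbitrary: n)
  case (0 n)
  then show ?case
    using string_head_eq_0[OF i, of "c 0" 0]
    by (simp add: string_decomp_iff divided_power_def q_fact_def)
next
  case (Suc N n)
  interpret EN: Vector_Spaces.linear "qsc M" "qsc M" "qe M i ^^ Suc N" by (rule linear_pow[OF linear_qe[OF i]])
  interpret D: Vector_Spaces.linear "qsc M" "qsc M" "divided_power M (qf M i) (Suc N)"
    by (rule divided_power_linear[OF i])
  have c: "\<And>n. n \<le> Suc N \<Longrightarrow> c n \<in> span (string_heads i n)"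
    and sum_0: "0 = (\<Sum>n\<le>Suc N. divided_power M (qf M i) n (c n))"
    using Suc.prems(1) unfolding string_decomp_iff by blast+
  have "0 = (\<Sum>n\<le>Suc N. (qe M i ^^ Suc N) (divided_power M (qf M i) n (c n)))"
    using arg_cong[OF sum_0, of "qe M i ^^ Suc N"] unfolding EN.sum EN.zero .
  also have "\<dots> = (\<Sum>n\<le>N. (qe M i ^^ Suc N) (divided_power M (qf M i) n (c n))) +
      (qe M i ^^ Suc N) (divided_power M (qf M i) (Suc N) (c (Suc N)))"
    by (rule sum.atMost_Suc)
  also have "(\<Sum>n\<le>N. (qe M i ^^ Suc N) (divided_power M (qf M i) n (c n))) = 0"
  proof (rule sum.neutral, rule ballI)
    fix n assume "n \<in> {..N}"
    then have "(qe M i ^^ Suc N) ((qf M i ^^ n) (c n)) = 0"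
      by (intro pow_qe_pow_qf_string_head[OF i] c) auto
    then show "(qe M i ^^ Suc N) (divided_power M (qf M i) n (c n)) = 0"
      unfolding divided_power_def EN.scale by (simp del: funpow.simps)
  qed
  finally have "(qe M i ^^ Suc N) ((qf M i ^^ Suc N) (c (Suc N))) = 0"
    unfolding divided_power_def EN.scale by (simp add: q_fact_nonzero del: funpow.simps)
  then have last: "c (Suc N) = 0" by (intro string_head_eq_0[OF i c]) auto
  then have "0 = (\<Sum>n\<le>N. divided_power M (qf M i) n (c n))"
    using sum_0 by (simp add: D.zero)
  then have "string_decomp l M i N c 0" using c by (simp add: string_decomp_iff)
  then have "n \<le> N \<Longrightarrow> c n = 0" by (rule Suc.IH)
  then show ?case using last Suc.prems(2) by (cases "n = Suc N") auto
qed

lemma string_decomp_extend: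
  assumes "i \<le> l" "string_decomp l M i N c u" "N \<le> K"
  shows "string_decomp l M i K (\<lambda>n. if n \<le> N then c n else 0) u"
proof -
  have "divided_power M (qf M i) n 0 = 0" for n
  proof -
    interpret D: Vector_Spaces.linear "qsc M" "qsc M" "divided_power M (qf M i) n"
      by (rule divided_power_linear[OF assms(1)])
    show ?thesis by (rule D.zero)
  qed
  then have "(\<Sum>n\<le>K. divided_power M (qf M i) n (if n \<le> N then c n else 0)) =
      (\<Sum>n\<le>N. divided_power M (qf M i) n (c n))"
    using assms(3) by (intro sum.mono_neutral_cong_right) auto
  then show ?thesis using assms(2) by (auto simp: string_decomp_iff span_zero)
qed

text \<open>Decompositions of different lengths are compared after padding with zeros; their
  difference is then a decomposition of 0.\<close>

lemma string_decomp_unique: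
  assumes i: "i \<le> l" and "string_decomp l M i N c u" "string_decomp l M i N' c' u"
  shows "(if n \<le> N then c n else 0) = (if n \<le> N' then c' n else 0)"
proof -
  \<comment> \<open>Including n in the maximum brings the index in question into the range covered
    by \<open>string_decomp_0\<close>.\<close>
  define K where "K = max (max N N') n"
  define C where "C n = (if n \<le> N then c n else 0)" for n
  define C' where "C' n = (if n \<le> N' then c' n else 0)" for n
  have "N \<le> K" "N' \<le> K" by (simp_all add: K_def)
  then have "string_decomp l M i K C u" "string_decomp l M i K C' u"
    using string_decomp_extend[OF i assms(2)] string_decomp_extend[OF i assms(3)]
    by (simp_all add: C_def[abs_def] C'_def[abs_def])
  moreover have "divided_power M (qf M i) n (C n - C' n) =
      divided_power M (qf M i) n (C n) - divided_power M (qf M i) n (C' n)" for n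
  proof -
    interpret D: Vector_Spaces.linear "qsc M" "qsc M" "divided_power M (qf M i) n"
      by (rule divided_power_linear[OF i])
    show ?thesis by (rule D.diff)
  qed
  ultimately have "string_decomp l M i K (\<lambda>n. C n - C' n) 0"
    by (simp add: string_decomp_iff span_diff sum_subtractf)
  then have "C n - C' n = 0" by (rule string_decomp_0[OF i]) (simp add: K_def)
  then show ?thesis by (simp add: C_def C'_def)
qed

text \<open>The condition on \<open>g\<close> makes zero padding harmless, and leaving
  \<open>g\<close> general serves both Kashiwara operators.\<close>

lemma string_sum_unique:
  assumes i: "i \<le> l" and "string_decomp l M i N c u" "string_decomp l M i N' c' u"
    and g: "\<And>n. g n 0 = (0 :: 'v)"
  shows "(\<Sum>n\<le>N. g n (c n)) = (\<Sum>n\<le>N'. g n (c' n))"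
proof -
  have ext: "(\<Sum>n\<le>max N N'. g n (if n \<le> m then b n else 0)) = (\<Sum>n\<le>m. g n (b n))"
    if "m \<le> max N N'" for m b
    using that g by (intro sum.mono_neutral_cong_right) auto
  show ?thesis
    using ext[of N c] ext[of N' c'] string_decomp_unique[OF assms(1-3)] by simp
qed

section \<open>Kashiwara operators computed from a given decomposition\<close>

lemma divided_power_0_right: "i \<le> l \<Longrightarrow> divided_power M (qf M i) n 0 = 0"
  using divided_power_linear module_hom.zero module_hom_iff_linear by blast

lemma kashiwara_f_eq:
  assumes i: "i \<le> l" and "string_decomp l M i N c u"
  shows "kashiwara_f l M i u = (\<Sum>n\<le>N. divided_power M (qf M i) (Suc n) (c n))"
  unfolding kashiwara_f_def
proof (rule the_equality)
  fix u' assume "\<exists>N c. string_decomp l M i N c u \<and>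
    u' = (\<Sum>n\<le>N. divided_power M (qf M i) (Suc n) (c n))"
  then show "u' = (\<Sum>n\<le>N. divided_power M (qf M i) (Suc n) (c n))"
    using string_sum_unique[OF i assms(2), of _ _ "\<lambda>n. divided_power M (qf M i) (Suc n)"]
      divided_power_0_right[OF i] by metis
qed (use assms(2) in blast)

lemma kashiwara_e_eq:
  assumes i: "i \<le> l" and "string_decomp l M i N c u"
  shows "kashiwara_e l M i u = (\<Sum>n<N. divided_power M (qf M i) n (c (Suc n)))"
proof -
  \<comment> \<open>Dropping the coefficient of index 0 explicitly rewrites the shifted sum as one
    over all coefficients, the form required by \<open>string_sum_unique\<close>.\<close>
  define g where "g n v = (if n = 0 then 0 else divided_power M (qf M i) (n - 1) v)" for n v
  have g: "(\<Sum>n<N. divided_power M (qf M i) n (c (Suc n))) = (\<Sum>n\<le>N. g n (c n))" for N c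
    unfolding lessThan_Suc_atMost[symmetric] sum.lessThan_Suc_shift by (simp add: g_def)
  have "g n 0 = 0" for n by (simp add: g_def divided_power_0_right[OF i])
  then show ?thesis
    unfolding kashiwara_e_def g using string_sum_unique[OF i assms(2), of _ _ g] assms(2)
    by (intro the_equality) metis+
qed

lemma kashiwara_e_eq_0:
  assumes i: "i \<le> l" and u: "\<mu> \<in> weight_lattice l" "u \<in> q_weight_space l M \<mu>" "0 \<le> hub l \<mu> i"
    and "qe M i u = 0"
  shows "kashiwara_e l M i u = 0"
proof -
  \<comment> \<open>The bound on the hub makes \<open>u\<close> a head for n = 0; with N = 0 the sum
    giving \<open>kashiwara_e\<close> is empty.\<close>
  have "string_decomp l M i 0 (\<lambda>_. u) u"
    using assms by (auto simp: string_decomp_iff string_heads_def divided_power_def q_fact_def intro!: span_base)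
  from kashiwara_e_eq[OF i this] show ?thesis by simp
qed

lemma kashiwara_f_eq_0:
  assumes i: "i \<le> l" and u: "\<mu> \<in> weight_lattice l" "u \<in> q_weight_space l M \<mu>"
    and m: "hub l \<mu> i = - int m" and f: "qf M i u = 0" and e: "(qe M i ^^ Suc m) u = 0"
  shows "kashiwara_f l M i u = 0"
proof -
  interpret fe: quantum_sl2 "qsc M" "qf M i" "qe M i" "\<lambda>t. K_eigenspace i (- t)"
    by (rule quantum_sl2_fe[OF i])
  interpret E: Vector_Spaces.linear "qsc M" "qsc M" "qe M i" by (rule linear_qe[OF i])
  interpret F: Vector_Spaces.linear "qsc M" "qsc M" "qf M i" by (rule linear_qf[OF i])
  interpret Fm: Vector_Spaces.linear "qsc M" "qsc M" "qf M i ^^ m" by (rule linear_pow[OF linear_qf[OF i]])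
  define r where "r = (\<Prod>k<m. qbracket (int k + 1) * qbracket (int m - int k))"
  have u': "u \<in> K_eigenspace i (- int m)" using weight_space_subset_K_eigenspace[OF i u(2)] m by simp
  have r: "r \<noteq> 0" unfolding r_def by (rule fe.prod_qbracket_nonzero) simp
  have bottom: "(qf M i ^^ m) ((qe M i ^^ m) u) = qsc M r u"
    unfolding r_def by (rule fe.pow_E_pow_F[OF u' f])
  \<comment> \<open>The head of the string through \<open>u\<close>: \<open>inverse r\<close> undoes
    the scalar by which raising and then lowering m times acts on \<open>u\<close>, and
    \<open>q_fact m\<close> cancels the denominator of the divided power.\<close>
  define y where "y = qsc M (q_fact m * inverse r) ((qe M i ^^ m) u)"
  have "y \<in> q_weight_space l M (\<mu> + root_shift l i (int m))"
    unfolding y_def by (rule subspace_scale[OF subspace_weight_space pow_qe_weight[OF u(2) i]])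
  moreover have "qe M i y = 0" using e by (simp add: y_def E.scale)
  moreover have "int m \<le> hub l (\<mu> + root_shift l i (int m)) i"
    using m by (simp add: hub_root_shift[OF rank i])
  ultimately have "y \<in> string_heads i m"
    using weight_lattice_add[OF u(1) root_shift_in_weight_lattice] by (auto simp: string_heads_def)
  define c where "c n = (if n = m then y else 0)" for n
  have fm: "(qf M i ^^ m) y = qsc M (q_fact m) u"
    using r by (simp add: y_def Fm.scale bottom)
  \<comment> \<open>With \<open>h\<close> the identity this verifies the decomposition of
    \<open>u\<close>; with \<open>h\<close> equal to \<open>Suc\<close> it evaluates
    \<open>kashiwara_f\<close>.\<close>
  have pick: "(\<Sum>n\<le>m. divided_power M (qf M i) (h n) (c n)) = divided_power M (qf M i) (h m) y" for h
    using divided_power_0_right[OF i]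
    by (subst sum.remove[of _ m]) (auto simp: c_def intro!: sum.neutral)
  have "divided_power M (qf M i) m y = u" using fm q_fact_nonzero by (simp add: divided_power_def)
  then have "string_decomp l M i m c u"
    unfolding string_decomp_iff pick[of "\<lambda>n. n"] using \<open>y \<in> string_heads i m\<close>
    by (auto simp: c_def span_base span_zero)
  from kashiwara_f_eq[OF i this] have "kashiwara_f l M i u = divided_power M (qf M i) (Suc m) y"
    unfolding pick .
  also have "\<dots> = 0" using fm f by (simp add: divided_power_def F.scale)
  finally show ?thesis .
qed

end


section \<open>Weights of the highest weight module\<close>

locale integrable_highest_weight = quantum_affine +
  fixes \<Lambda> :: weight
  assumes highest: "is_Vq l \<Lambda> M" and integrable: "integrable l M"
    and \<Lambda>_lattice: "\<Lambda> \<in> weight_lattice l" and dominant: "i \<le> l \<Longrightarrow> 0 \<le> hub l \<Lambda> i"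
begin

inductive_set lowerings :: "'a \<Rightarrow> 'a set" for v where
  base: "v \<in> lowerings v"
| step: "x \<in> lowerings v \<Longrightarrow> i \<le> l \<Longrightarrow> qf M i x \<in> lowerings v"

lemma lowerings_weight:
  assumes "x \<in> lowerings v" "v \<in> q_weight_space l M \<Lambda>"
  shows "\<exists>\<beta>\<in>root_cone l. x \<in> q_weight_space l M (\<Lambda> - \<beta>)"
  using assms(1)
proof induction
  case base
  show ?case using root_cone.zero assms(2) by (intro bexI[of _ 0]) auto
next
  case (step x i)
  then obtain \<beta> where "\<beta> \<in> root_cone l" "x \<in> q_weight_space l M (\<Lambda> - \<beta>)" by blast
  then show ?case
    using root_cone.add[of \<beta> l i] qf_weight[of x "\<Lambda> - \<beta>" i] step.hyps(2)
    by (intro bexI[of _ "\<beta> + simple_root l i"]) (simp_all add: diff_diff_eq)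
qed

lemma qf_span_lowerings:
  assumes "i \<le> l" "x \<in> span (lowerings v)"
  shows "qf M i x \<in> span (lowerings v)"
proof -
  interpret F: Vector_Spaces.linear "qsc M" "qsc M" "qf M i" by (rule linear_qf[OF assms(1)])
  show ?thesis using assms(2)
    by (induction rule: span_induct_alt)
      (auto simp: F.zero F.add F.scale span_zero intro!: span_add span_scale span_base[OF lowerings.step[OF _ assms(1)]])
qed

text \<open>Moving \<open>qe\<close> past the outermost \<open>qf\<close> leaves an error of 0 or,
  for equal indices, a multiple of the weight vector x; the rest is the induction hypothesis
  followed by one lowering.\<close>

lemma qe_lowerings:
  assumes "x \<in> lowerings v" "v \<in> q_weight_space l M \<Lambda>" "\<And>i. i \<le> l \<Longrightarrow> qe M i v = 0" "i \<le> l"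
  shows "qe M i x \<in> span (lowerings v)"
  using assms(1)
proof induction
  case base
  show ?case using assms(3,4) by (simp add: span_zero)
next
  case (step x j)
  obtain \<mu> where \<mu>: "x \<in> q_weight_space l M \<mu>" using lowerings_weight[OF step.hyps(1) assms(2)] by blast
  have "qe M i (qf M j x) - qf M j (qe M i x) \<in> span (lowerings v)"
  proof (cases "i = j")
    case True
    then show ?thesis
      using qe_qf_eigen[OF weight_space_subset_K_eigenspace[OF assms(4) \<mu>] assms(4)] step.hyps(1)
      by (simp add: span_scale span_base)
  next
    case False
    then show ?thesis using qe_qf[OF assms(4) step.hyps(2)] by (simp add: span_zero)
  qed
  from span_add[OF this qf_span_lowerings[OF step.hyps(2) step.IH]] show ?case by simp
qed

lemma linear_span_subset:
  assumes "Vector_Spaces.linear (qsc M) (qsc M) T" "\<And>x. x \<in> A \<Longrightarrow> T x \<in> span A"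
  shows "T ` span A \<subseteq> span A"
proof -
  interpret T: Vector_Spaces.linear "qsc M" "qsc M" T by (rule assms(1))
  have "T ` span A = span (T ` A)" by (simp add: T.span_image)
  also have "\<dots> \<subseteq> span A" using assms(2) by (intro span_minimal) auto
  finally show ?thesis .
qed

text \<open>The span is stable under every generator, under \<open>qk\<close> because lowerings are
  weight vectors, and it contains the nonzero highest weight vector, so irreducibility makes it
  everything.\<close>

lemma spanned_by_lowerings:
  obtains v where "v \<in> q_weight_space l M \<Lambda>" "span (lowerings v) = UNIV"
proof -
  obtain v where v: "v \<in> q_weight_space l M \<Lambda>" "v \<noteq> 0" "\<And>i. i \<le> l \<Longrightarrow> qe M i v = 0"
    and irr: "irreducible_ops (qsc M) (quantum_ops l M)"
    using highest unfolding is_Vq_def by blast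
  have lin: "Vector_Spaces.linear (qsc M) (qsc M) T" if "T \<in> quantum_ops l M" for T
    using quantum_module that by (simp add: is_quantum_module_def)
  have "T x \<in> span (lowerings v)" if T: "T \<in> quantum_ops l M" and x: "x \<in> lowerings v" for T x
  proof -
    consider i where "i \<le> l" "T = qe M i" | i where "i \<le> l" "T = qf M i"
      | h where "h \<in> coweight_lattice l" "T = qk M h"
      using T unfolding quantum_ops_def by blast
    then show ?thesis
    proof cases
      case 1
      then show ?thesis using qe_lowerings[OF x v(1,3)] by simp
    next
      case 2
      then show ?thesis using lowerings.step[OF x] by (simp add: span_base)
    next
      case 3
      then show ?thesis using lowerings_weight[OF x v(1)] x
        by (auto simp: q_weight_space_def span_scale span_base)
    qed
  qed
  then have "T ` span (lowerings v) \<subseteq> span (lowerings v)" if "T \<in> quantum_ops l M" for T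
    using linear_span_subset[OF lin[OF that]] that by blast
  then have "span (lowerings v) = {0} \<or> span (lowerings v) = UNIV"
    using irr subspace_span[of "lowerings v"] unfolding irreducible_ops_def by blast
  then show thesis using that[OF v(1)] v(2) span_base[OF lowerings.base[of v]] by blast
qed

text \<open>The vector x is a sum of weight vectors with weights in \<Lambda> minus the cone. If
  \<nu> were not among these weights, subtracting x would give a relation contradicting
  independence.\<close>

lemma weight_in_root_cone:
  assumes x: "x \<in> q_weight_space l M \<nu>" "x \<noteq> 0" and \<nu>: "\<nu> \<in> weight_lattice l"
  shows "\<Lambda> - \<nu> \<in> root_cone l"
proof (rule ccontr)
  assume not_below: "\<Lambda> - \<nu> \<notin> root_cone l"
  obtain v where v: "v \<in> q_weight_space l M \<Lambda>" "span (lowerings v) = UNIV"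
    by (rule spanned_by_lowerings)
  define I where "I = (\<lambda>\<beta>. \<Lambda> - \<beta>) ` root_cone l"
  have "lowerings v \<subseteq> (\<Union>\<mu>\<in>I. q_weight_space l M \<mu>)"
    using lowerings_weight[OF _ v(1)] by (auto simp: I_def)
  then have x_span: "x \<in> span (\<Union>\<mu>\<in>I. q_weight_space l M \<mu>)" using v(2) span_mono by blast
  obtain S w where S: "finite S" "S \<subseteq> I" "\<And>\<mu>. \<mu> \<in> S \<Longrightarrow> w \<mu> \<in> q_weight_space l M \<mu>"
    "x = (\<Sum>\<mu>\<in>S. w \<mu>)"
    by (rule span_UN_subspaces[OF x_span subspace_weight_space]) blast
  have "\<nu> \<notin> S" using S(2) not_below by (auto simp: I_def)
  have "I \<subseteq> weight_lattice l"
    unfolding I_def using \<Lambda>_lattice weight_lattice_diff root_cone_subset_weight_lattice by blast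
  with S(2) have "S \<subseteq> weight_lattice l" by blast
  define w' where "w' = w(\<nu> := - x)"
  have "w' \<nu> = 0"
  proof (rule weight_vectors_independent)
    show "insert \<nu> S \<subseteq> weight_lattice l" using \<nu> \<open>S \<subseteq> weight_lattice l\<close> by simp
    show "w' \<mu> \<in> q_weight_space l M \<mu>" if "\<mu> \<in> insert \<nu> S" for \<mu>
      using that S(3) x(1) by (cases "\<mu> = \<nu>") (auto simp: w'_def subspace_neg[OF subspace_weight_space])
    have "(\<Sum>\<mu>\<in>S. w' \<mu>) = x" unfolding S(4) using \<open>\<nu> \<notin> S\<close> by (intro sum.cong) (auto simp: w'_def)
    then show "(\<Sum>\<mu>\<in>insert \<nu> S. w' \<mu>) = 0" using S(1) \<open>\<nu> \<notin> S\<close> by (simp add: w'_def)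
  qed (use S(1) in auto)
  then show False using x(2) by (simp add: w'_def)
qed

text \<open>
  Reflecting in a vertex with negative hub entry keeps the defect and lowers the height of
  \<open>\<Lambda> - \<nu>\<close>, so it suffices to treat dominant weights, where \<open>2 def(\<nu>) = (\<Lambda> + \<nu> | \<Lambda> - \<nu>)\<close>.
\<close>

lemma defect_nonneg:
  assumes "x \<in> q_weight_space l M \<nu>" "x \<noteq> 0" "\<nu> \<in> weight_lattice l"
  shows "0 \<le> defect l \<Lambda> \<nu>"
  using assms
\<comment> \<open>The measure is the height of \<open>\<Lambda> - \<nu>\<close>; floor and
  \<open>nat\<close> only convert it to a natural number.\<close>
proof (induction "nat \<lfloor>wt_form l (weyl_vector l) (\<Lambda> - \<nu>)\<rfloor>" arbitrary: \<nu> x rule: less_induct)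
  case less
  have cone: "\<Lambda> - \<nu> \<in> root_cone l" using weight_in_root_cone less.prems by blast
  show ?case
  proof (cases "\<forall>i\<le>l. 0 \<le> hub l \<nu> i")
    case True
    then have "0 \<le> hub l (\<Lambda> + \<nu>) i" if "i \<le> l" for i
      using that dominant[OF that] by (simp add: hub_def pairing_add_left)
    then have "0 \<le> wt_form l (\<Lambda> + \<nu>) (\<Lambda> - \<nu>)" by (rule wt_form_root_cone_nonneg[OF cone rank])
    then show ?thesis using defect_eq[of l \<Lambda> \<nu>] by simp
  next
    case False
    then obtain i where i: "i \<le> l" "hub l \<nu> i < 0" by auto
    define m where "m = - hub l \<nu> i"
    define \<nu>' where "\<nu>' = \<nu> + root_shift l i m"
    obtain n where n: "(qf M i ^^ n) x = 0" using integrable i(1) unfolding integrable_def by blast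
    obtain y where y: "y \<in> q_weight_space l M \<nu>'" "y \<noteq> 0"
      by (rule reflected_weight_vector[OF i(1) less.prems(1,2) n i(2)]) (simp add: \<nu>'_def m_def)
    have \<nu>': "\<nu>' \<in> weight_lattice l"
      unfolding \<nu>'_def using weight_lattice_add[OF less.prems(3) root_shift_in_weight_lattice] .
    \<comment> \<open>Nonnegativity at \<open>\<nu>'\<close> ensures that the drop by m is not lost
      when \<open>nat\<close> truncates.\<close>
    have "0 \<le> wt_form l (weyl_vector l) (\<Lambda> - \<nu>')"
      by (rule wt_form_root_cone_nonneg[OF weight_in_root_cone[OF y \<nu>'] rank]) (simp add: hub_weyl_vector)
    moreover have "wt_form l (weyl_vector l) (\<Lambda> - \<nu>') = wt_form l (weyl_vector l) (\<Lambda> - \<nu>) - of_int m"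
      by (simp add: \<nu>'_def wt_form_diff_right wt_form_add_right wt_form_root_shift[OF rank i(1)]
          hub_weyl_vector[OF i(1)])
    ultimately have "nat \<lfloor>wt_form l (weyl_vector l) (\<Lambda> - \<nu>')\<rfloor> < nat \<lfloor>wt_form l (weyl_vector l) (\<Lambda> - \<nu>)\<rfloor>"
      using i(2) by (simp add: m_def)
    from less.hyps[OF this y \<nu>'] have "0 \<le> defect l \<Lambda> \<nu>'" .
    then show ?thesis
      unfolding \<nu>'_def defect_root_shift[OF rank i(1)] by (simp add: m_def)
  qed
qed

text \<open>By \<open>defect_root_shift\<close> the shifted weight has defect
  \<open>d - k * (hub l \<mu> i + k)\<close>, which is negative here, so
  \<open>defect_nonneg\<close> rules out a nonzero vector.\<close>

lemma weight_vector_eq_0: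
  assumes "x \<in> q_weight_space l M (\<mu> + root_shift l i k)" "\<mu> \<in> weight_lattice l" "i \<le> l"
    and "defect l \<Lambda> \<mu> = of_int d" "d < k * (hub l \<mu> i + k)"
  shows "x = 0"
proof (rule ccontr)
  assume "x \<noteq> 0"
  from defect_nonneg[OF assms(1) this weight_lattice_add[OF assms(2) root_shift_in_weight_lattice]]
  have "0 \<le> (of_int (d - (k * hub l \<mu> i + k * k)) :: rat)"
    unfolding defect_root_shift[OF rank assms(3)] assms(4) by simp
  then show False using assms(5) unfolding of_int_0_le_iff by (simp add: algebra_simps)
qed

end


section \<open>Crystal lattices\<close>

lemma regular_at_0_diff: "x \<in> regular_at_0 \<Longrightarrow> y \<in> regular_at_0 \<Longrightarrow> x - y \<in> regular_at_0"
proof -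
  assume "x \<in> regular_at_0" "y \<in> regular_at_0"
  then obtain a b c d where x: "x = Fract a b" "poly b 0 \<noteq> 0" and y: "y = Fract c d" "poly d 0 \<noteq> 0"
    by (auto simp: regular_at_0_def)
  then have "x - y = Fract (a * d - c * b) (b * d)" by (subst diff_fract[symmetric]) auto
  moreover have "poly (b * d) 0 \<noteq> 0" using x y by simp
  ultimately show ?thesis unfolding regular_at_0_def by blast
qed

lemma zero_regular_at_0: "0 \<in> regular_at_0"
  unfolding regular_at_0_def mem_Collect_eq
  by (rule exI[of _ 0], rule exI[of _ 1]) (simp add: Zero_fract_def)

lemma crystal_baseD:
  assumes "crystal_base l M L B"
  shows "integrable l M" "is_lattice M L" "is_rat_basis M L B"
    and "u \<in> L \<Longrightarrow> \<exists>S w. finite S \<and> S \<subseteq> weight_lattice l \<and>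
        (\<forall>\<mu>\<in>S. w \<mu> \<in> L \<inter> q_weight_space l M \<mu>) \<and> u = (\<Sum>\<mu>\<in>S. w \<mu>)"
    and "b \<in> B \<Longrightarrow> \<exists>\<mu>\<in>weight_lattice l. b \<inter> q_weight_space l M \<mu> \<noteq> {}"
    and "i \<le> l \<Longrightarrow> b \<in> B \<Longrightarrow> crystal_e l M L i b \<in> insert (qL M L) B"
    and "i \<le> l \<Longrightarrow> b \<in> B \<Longrightarrow> crystal_f l M L i b \<in> insert (qL M L) B"
proof -
  note conjs = assms[unfolded crystal_base_def]
  show "integrable l M" by (rule conjs[THEN conjunct1])
  note conjs = conjs[THEN conjunct2]
  show "is_lattice M L" by (rule conjs[THEN conjunct1])
  note conjs = conjs[THEN conjunct2]
  show "is_rat_basis M L B" by (rule conjs[THEN conjunct1])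
  note conjs = conjs[THEN conjunct2]
  show "\<exists>S w. finite S \<and> S \<subseteq> weight_lattice l \<and>
      (\<forall>\<mu>\<in>S. w \<mu> \<in> L \<inter> q_weight_space l M \<mu>) \<and> u = (\<Sum>\<mu>\<in>S. w \<mu>)" if "u \<in> L"
    by (rule conjs[THEN conjunct1, THEN bspec, OF that])
  note conjs = conjs[THEN conjunct2]
  show "\<exists>\<mu>\<in>weight_lattice l. b \<inter> q_weight_space l M \<mu> \<noteq> {}" if "b \<in> B"
    by (rule conjs[THEN conjunct1, THEN bspec, OF that])
  note ops = conjs[THEN conjunct2, THEN conjunct2, THEN conjunct1, rule_format]
  show "crystal_e l M L i b \<in> insert (qL M L) B" if "i \<le> l" "b \<in> B"
    by (rule ops[OF that, THEN conjunct1])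
  show "crystal_f l M L i b \<in> insert (qL M L) B" if "i \<le> l" "b \<in> B"
    by (rule ops[OF that, THEN conjunct2])
qed

lemma is_rat_basis_subset: "is_rat_basis M L B \<Longrightarrow> B \<subseteq> coset_of M L ` L"
  unfolding is_rat_basis_def by (elim conjE)

section \<open>Cosets modulo \<open>qL\<close> and the weights of basis elements\<close>

context quantum_affine
begin

lemma is_lattice_0:
  assumes "is_lattice M L"
  shows "0 \<in> L"
  using assms unfolding is_lattice_def
  by (auto intro!: exI[of _ "{}"])

lemma is_lattice_diff:
  assumes "is_lattice M L" "u \<in> L" "v \<in> L"
  shows "u - v \<in> L"
proof -
  obtain X where L: "L = {\<Sum>x\<in>S. qsc M (a x) x | S a. finite S \<and> S \<subseteq> X \<and> a ` S \<subseteq> regular_at_0}"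
    using assms(1) unfolding is_lattice_def by blast
  obtain S a where S: "u = (\<Sum>x\<in>S. qsc M (a x) x)" "finite S" "S \<subseteq> X" "a ` S \<subseteq> regular_at_0"
    using assms(2) unfolding L by blast
  obtain T b where T: "v = (\<Sum>x\<in>T. qsc M (b x) x)" "finite T" "T \<subseteq> X" "b ` T \<subseteq> regular_at_0"
    using assms(3) unfolding L by blast
  define c where "c x = (if x \<in> S then a x else 0) - (if x \<in> T then b x else 0)" for x
  have u: "u = (\<Sum>x\<in>S \<union> T. qsc M (if x \<in> S then a x else 0) x)"
    unfolding S(1) using S(2) T(2) by (intro sum.mono_neutral_cong_left) auto
  have v: "v = (\<Sum>x\<in>S \<union> T. qsc M (if x \<in> T then b x else 0) x)"
    unfolding T(1) using S(2) T(2) by (intro sum.mono_neutral_cong_left) auto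
  have "u - v = (\<Sum>x\<in>S \<union> T. qsc M (c x) x)"
    unfolding u v c_def scale_left_diff_distrib by (rule sum_subtractf[symmetric])
  moreover have "c ` (S \<union> T) \<subseteq> regular_at_0"
    using S(4) T(4) unfolding image_subset_iff
    by (auto simp: c_def simp del: diff_0 intro!: regular_at_0_diff zero_regular_at_0)
  ultimately show ?thesis unfolding L using S(2,3) T(2,3) by blast
qed

lemma qL_0: "is_lattice M L \<Longrightarrow> 0 \<in> qL M L"
  using is_lattice_0 by (force simp: qL_def)

lemma qL_diff: "is_lattice M L \<Longrightarrow> u \<in> qL M L \<Longrightarrow> v \<in> qL M L \<Longrightarrow> u - v \<in> qL M L"
  using is_lattice_diff by (auto simp: qL_def simp flip: scale_right_diff_distrib)

lemma coset_eq_qL: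
  assumes L: "is_lattice M L" and 0: "0 \<in> coset_of M L u"
  shows "coset_of M L u = qL M L"
proof -
  obtain w where w: "u + w = 0" "w \<in> qL M L" using 0 by (auto simp: coset_of_def)
  then have u: "u = 0 - w" by (simp add: eq_neg_iff_add_eq_0)
  have "x \<in> coset_of M L u \<longleftrightarrow> x \<in> qL M L" for x
  proof
    assume "x \<in> coset_of M L u"
    then show "x \<in> qL M L" using qL_diff[OF L _ w(2)] by (auto simp: coset_of_def u)
  next
    assume "x \<in> qL M L"
    then have "x + w \<in> qL M L" using qL_diff[OF L _ qL_diff[OF L qL_0[OF L] w(2)], of x] by simp
    then show "x \<in> coset_of M L u" by (auto simp: coset_of_def u intro!: exI[of _ "x + w"])
  qed
  then show ?thesis by blast
qed

lemma zero_notin_basis: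
  assumes "is_lattice M L" "is_rat_basis M L B" "b \<in> B"
  shows "0 \<notin> b"
proof
  assume "0 \<in> b"
  note independent = assms(2)[unfolded is_rat_basis_def, THEN conjunct2, THEN conjunct1, rule_format]
  \<comment> \<open>If 0 represented \<open>b\<close>, then 1 times 0 would be a relation in
    \<open>qL\<close> with a nonzero coefficient.\<close>
  from independent[of "{b}" "\<lambda>_. 0" "\<lambda>_. 1"] show False
    using \<open>0 \<in> b\<close> assms(3) qL_0[OF assms(1)] by simp
qed

text \<open>The lattice splits by weight, so the \<mu>-component of \<open>u - u'\<close>, which is
  \<open>u\<close> itself, is again \<open>qvar\<close> times a lattice element.\<close>

lemma weight_vector_in_qL:
  assumes decomp: "\<And>u. u \<in> L \<Longrightarrow> \<exists>S w. finite S \<and> S \<subseteq> weight_lattice l \<and>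
      (\<forall>\<mu>\<in>S. w \<mu> \<in> L \<inter> q_weight_space l M \<mu>) \<and> u = (\<Sum>\<mu>\<in>S. w \<mu>)"
    and L: "is_lattice M L" and "u - u' \<in> qL M L" "\<mu> \<noteq> \<mu>'"
    and \<mu>: "\<mu> \<in> weight_lattice l" "u \<in> q_weight_space l M \<mu>"
    and \<mu>': "\<mu>' \<in> weight_lattice l" "u' \<in> q_weight_space l M \<mu>'"
  shows "u \<in> qL M L"
proof -
  obtain y where y: "u - u' = qsc M qvar y" "y \<in> L" using assms(3) by (auto simp: qL_def)
  obtain S w where S: "finite S" "S \<subseteq> weight_lattice l"
    "\<And>\<xi>. \<xi> \<in> S \<Longrightarrow> w \<xi> \<in> L \<inter> q_weight_space l M \<xi>" "y = (\<Sum>\<xi>\<in>S. w \<xi>)"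
    using decomp[OF y(2)] by blast
  define w0 where "w0 \<xi> = (if \<xi> \<in> S then w \<xi> else 0)" for \<xi>
  have w0: "w0 \<xi> \<in> L" "w0 \<xi> \<in> q_weight_space l M \<xi>" for \<xi>
    using S(3)[of \<xi>] is_lattice_0[OF L] subspace_0[OF subspace_weight_space] by (auto simp: w0_def)
  define T where "T = S \<union> {\<mu>, \<mu>'}"
  \<comment> \<open>The weight-by-weight difference of the two expressions for
    \<open>u - u'\<close>; independence makes every entry vanish.\<close>
  define z where "z \<xi> = qsc M qvar (w0 \<xi>) - (if \<xi> = \<mu> then u else 0) + (if \<xi> = \<mu>' then u' else 0)" for \<xi>
  have T: "finite T" "T \<subseteq> weight_lattice l" using S(1,2) \<mu>(1) \<mu>'(1) by (auto simp: T_def)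
  have z: "z \<xi> \<in> q_weight_space l M \<xi>" for \<xi>
    unfolding z_def using \<mu>(2) \<mu>'(2) w0(2)[of \<xi>]
    by (intro subspace_add[OF subspace_weight_space] subspace_diff[OF subspace_weight_space]
        subspace_scale[OF subspace_weight_space])
      (auto simp: subspace_0[OF subspace_weight_space])
  have "(\<Sum>\<xi>\<in>T. w0 \<xi>) = y"
    unfolding S(4) w0_def using T(1) by (intro sum.mono_neutral_cong_right) (auto simp: T_def)
  then have "(\<Sum>\<xi>\<in>T. z \<xi>) = qsc M qvar y - u + u'"
    using T(1) by (simp add: z_def sum.distrib sum_subtractf T_def flip: scale_sum_right)
  also have "\<dots> = 0" unfolding y(1)[symmetric] by simp
  finally have "z \<mu> = 0"
    using weight_vectors_independent[OF T z] by (simp add: T_def)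
  then have "u = qsc M qvar (w0 \<mu>)" using assms(4) by (simp add: z_def)
  then show ?thesis using w0(1) by (simp add: qL_def)
qed

text \<open>Representatives of two different weights would lie in \<open>qL\<close>, forcing 0 into
  \<open>b\<close>; hence the definite description in \<open>crystal_wt\<close> denotes a
  weight.\<close>

lemma crystal_wt_vector:
  assumes base: "crystal_base l M L B" and b: "b \<in> B"
  obtains u where "u \<in> b" "u \<in> q_weight_space l M (crystal_wt l M b)" "crystal_wt l M b \<in> weight_lattice l"
proof -
  note L = crystal_baseD(2)[OF base] and basis = crystal_baseD(3)[OF base]
    and decomp = crystal_baseD(4)[OF base]
  obtain r where r: "b = coset_of M L r" using is_rat_basis_subset[OF basis] b by blast
  have 0: "0 \<notin> b" by (rule zero_notin_basis[OF L basis b])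
  define P where "P \<mu> \<longleftrightarrow> \<mu> \<in> weight_lattice l \<and> b \<inter> q_weight_space l M \<mu> \<noteq> {}" for \<mu>
  have "\<exists>!\<mu>. P \<mu>"
  proof (rule ex_ex1I)
    show "\<exists>\<mu>. P \<mu>" using crystal_baseD(5)[OF base b] unfolding P_def by blast
    fix \<mu> \<mu>' assume "P \<mu>" "P \<mu>'"
    then obtain u u' where u: "u \<in> b" "u \<in> q_weight_space l M \<mu>" "\<mu> \<in> weight_lattice l"
      and u': "u' \<in> b" "u' \<in> q_weight_space l M \<mu>'" "\<mu>' \<in> weight_lattice l"
      unfolding P_def by blast
    obtain w w' where w: "u = r + w" "w \<in> qL M L" "u' = r + w'" "w' \<in> qL M L"
      using u(1) u'(1) unfolding r coset_of_def by blast
    show "\<mu> = \<mu>'"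
    proof (rule ccontr)
      assume "\<mu> \<noteq> \<mu>'"
      moreover have "u - u' \<in> qL M L" using qL_diff[OF L w(2,4)] by (simp add: w(1,3))
      ultimately have "u \<in> qL M L" using weight_vector_in_qL[OF decomp L _ _ u(3,2) u'(3,2)] by blast
      then have "w - u \<in> qL M L" using qL_diff[OF L w(2)] by blast
      moreover have "0 = r + (w - u)" using w(1) by simp
      ultimately show False using 0 unfolding r coset_of_def by blast
    qed
  qed
  from theI'[OF this] show thesis using that unfolding P_def crystal_wt_def by blast
qed

text \<open>By the closure condition the union over all representatives is a single coset. One
  representative killed by \<open>T\<close> puts 0 into it, which identifies it as
  \<open>qL\<close>.\<close>

lemma crystal_op_eq_qL:
  assumes L: "is_lattice M L" and "B \<subseteq> coset_of M L ` L" "crystal_op M L T b \<in> insert (qL M L) B"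
    and "u \<in> b" "T u = 0"
  shows "crystal_op M L T b = qL M L"
proof -
  have "0 \<in> coset_of M L (T u)" using qL_0[OF L] assms(5) by (force simp: coset_of_def)
  then have "0 \<in> crystal_op M L T b" using assms(4) unfolding crystal_op_def by blast
  then show ?thesis using assms(2,3) coset_eq_qL[OF L] by blast
qed

end


theorem proposition3p1:
  fixes l d i :: nat and a :: "nat \<Rightarrow> nat" and \<Lambda> \<mu> :: weight
    and V :: "'v::ab_group_add affine_module"
    and M :: "'w::ab_group_add quantum_module" and L :: "'w set" and B :: "'w set set"
  assumes "1 \<le> l"
    and "\<Lambda> = dominant_weight l a"
    and "is_V l \<Lambda> V"
    and "is_Vq l \<Lambda> M" and "crystal_base l M L B"
    and "0 < d" and "\<mu> \<in> weights l V" and "defect l \<Lambda> \<mu> = of_nat d"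
    and "i \<le> l"
    and "int d \<le> \<bar>hub l \<mu> i\<bar>"
  shows "external_weight l M L B i \<mu>"
  unfolding external_weight_def
proof (intro ballI impI)
  fix b assume b: "b \<in> B" and wt: "crystal_wt l M b = \<mu>"
  note crystal = assms(5) and i = assms(9)
  interpret integrable_highest_weight l M \<Lambda>
  proof
    show "is_quantum_module l M" using assms(4) by (simp add: is_Vq_def)
    show "integrable l M" using crystal by (simp add: crystal_base_def)
    show "\<Lambda> \<in> weight_lattice l" by (simp add: assms(2) dominant_weight_eq weight_lattice_def)
    show "0 \<le> hub l \<Lambda> i" if "i \<le> l" for i
      using that by (simp add: assms(2) hub_eq dominant_weight_eq)
  qed (use assms in auto)
  have def: "defect l \<Lambda> \<mu> = of_int (int d)" using assms(8) by simp
  obtain u where u: "u \<in> b" "u \<in> q_weight_space l M \<mu>" "\<mu> \<in> weight_lattice l"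
    using crystal_wt_vector[OF crystal b] wt by blast
  note L = crystal_baseD(2)[OF crystal] and B = is_rat_basis_subset[OF crystal_baseD(3)[OF crystal]]
    and ops = crystal_baseD(6,7)[OF crystal i b]
  show "external_element l M L i b"
    unfolding external_element_def wt
  proof (intro conjI impI)
    assume pos: "0 < hub l \<mu> i"
    have "qe M i u \<in> q_weight_space l M (\<mu> + root_shift l i 1)"
      using qe_weight[OF u(2) i] by simp
    then have "qe M i u = 0"
      by (rule weight_vector_eq_0[OF _ u(3) i def]) (use assms(10) pos in simp)
    then have "kashiwara_e l M i u = 0"
      using kashiwara_e_eq_0[OF i u(3,2)] pos by simp
    then show "crystal_e l M L i b = qL M L"
      using crystal_op_eq_qL[OF L B] ops(1) u(1) unfolding crystal_e_def by blast
  next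
    assume neg: "hub l \<mu> i < 0"
    define m where "m = nat (- hub l \<mu> i)"
    have m: "hub l \<mu> i = - int m" "int d \<le> int m" using neg assms(10) by (simp_all add: m_def)
    \<comment> \<open>Both shifts used below, k = -1 and k = m + 1, turn the bound of
      \<open>weight_vector_eq_0\<close> into \<open>d < m + 1\<close>.\<close>
    have "qf M i u \<in> q_weight_space l M (\<mu> + root_shift l i (- 1))"
      using pow_qf_weight[OF u(2) i, of 1] by simp
    then have f: "qf M i u = 0"
      by (rule weight_vector_eq_0[OF _ u(3) i def]) (use m in simp)
    have "(qe M i ^^ Suc m) u = 0"
      by (rule weight_vector_eq_0[OF pow_qe_weight[OF u(2) i] u(3) i def]) (use m in simp)
    from kashiwara_f_eq_0[OF i u(3,2) m(1) f this]
    show "crystal_f l M L i b = qL M L"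
      using crystal_op_eq_qL[OF L B] ops(2) u(1) unfolding crystal_f_def by blast
  qed
qed

end
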